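(* Let $(M,\omega)$ be a symplectic manifold with a star product $*$ on $C^\infty(M)((\hbar^{\mathbb{Q}}))$, let $\rho:C^{\infty}(M)((\hbar^{\mathbb{Q}}))\to\mathbb{C}((\hbar^{\mathbb{Q}}))$ be a state, and let $X_1,X_2\in C^{\infty}(M)((\hbar^{\mathbb{Q}}))$ satisfy $\overline{X_j}=X_j$; put $\delta X_j:=X_j-\rho(X_j)$. Then $\rho$ is a Robertson–Schrödinger intelligent state for $X_1,X_2$ if and only if there exist $u_1,u_2\in\mathbb{C}((\hbar^{\mathbb{Q}}))$, not both zero, such that $u_1\,\delta X_1+u_2\,\delta X_2\in\mathcal{J}_\rho$.
   Context: For a field $\mathbb{K}$, $\mathbb{K}((\hbar^{\mathbb{Q}}))$ is the field of formal series $a=\sum_{q\in\mathbb{Q}}a_q\hbar^q$, $a_q\in\mathbb{K}$, whose support $\{q:a_q\neq0\}$ is well-ordered (every nonempty subset has a least element), with the usual addition and product. $\mathbb{R}((\hbar^{\mathbb{Q}}))$ is ordered by: $a>0$ iff $a\ne 0$ and $a_{q_0}>0$, where $q_0=\min\operatorname{supp}a$. $\mathbb{C}((\hbar^{\mathbb{Q}}))=\mathbb{R}((\hbar^{\mathbb{Q}}))+i\,\mathbb{R}((\hbar^{\mathbb{Q}}))$. $C^\infty(M)((\hbar^{\mathbb{Q}}))$ is the $\mathbb{C}((\hbar^{\mathbb{Q}}))$-vector space of such series with coefficients in the complex-valued smooth functions on $M$. The overbar denotes coefficientwise complex conjugation ($\hbar$ is real). A star product is an associative $\mathbb{C}((\hbar^{\mathbb{Q}}))$-bilinear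 product of the form $f*g=\sum_{k=0}^\infty C_k(f,g)\hbar^k$, where the $C_k$ are bidifferential operators (acting coefficientwise) mapping $C^\infty(M)\times C^\infty(M)$ to $C^\infty(M)$, with $C_0(f,g)=fg$, $C_k(1,f)=C_k(f,1)=0$ for $k\ge1$, and $C_1(f,g)-C_1(g,f)=i\{f,g\}$, where $\{\cdot,\cdot\}$ is the Poisson bracket of $(M,\omega)$. A $\mathbb{C}((\hbar^{\mathbb{Q}}))$-linear functional $\rho:C^\infty(M)((\hbar^{\mathbb{Q}}))\to\mathbb{C}((\hbar^{\mathbb{Q}}))$ is positive if $\rho(\overline f*f)\ge0$ (in particular lies in $\mathbb{R}((\hbar^{\mathbb{Q}}))$) for all $f$; it is a state if moreover $\rho(1)=1$. The Gel'fand ideal of $\rho$ is $\mathcal{J}_\rho:=\{f:\rho(\overline f*f)=0\}$. A state $\rho$ is called a Robertson–Schrödinger intelligent state for real elements $X_1,\dots,X_n$ if $\det(\frac12\rho(\delta X_j*\delta X_k+\delta X_k*\delta X_j))=\det(\frac{\hbar}{2}\rho(\{X_j,X_k\}_* ))$, where $\{X_j,X_k\}_*:=\frac{1}{i\hbar}(X_j*X_k-X_k*X_j)$. *)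

theory Defs
  imports "HOL-Analysis.Analysis" "HOL-Library.Function_Algebras"
begin

section \<open>Formal series with well-ordered rational support\<close>

definition well_ordered_set :: "rat set \<Rightarrow> bool" where
  "well_ordered_set S \<longleftrightarrow> (\<forall>T\<subseteq>S. T \<noteq> {} \<longrightarrow> (\<exists>m\<in>T. \<forall>t\<in>T. m \<le> t))"

lemma well_ordered_setD:
  assumes "well_ordered_set S" "T \<subseteq> S" "T \<noteq> {}"
  obtains m where "m \<in> T" "\<And>t. t \<in> T \<Longrightarrow> m \<le> t"
  using assms unfolding well_ordered_set_def by metis

lemma well_ordered_set_subset: "well_ordered_set S \<Longrightarrow> T \<subseteq> S \<Longrightarrow> well_ordered_set T"
  unfolding well_ordered_set_def by (meson subset_trans)

lemma well_ordered_set_Un: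
  assumes "well_ordered_set A" "well_ordered_set B"
  shows "well_ordered_set (A \<union> B)"
  unfolding well_ordered_set_def
proof (intro allI impI)
  fix T assume T: "T \<subseteq> A \<union> B" "T \<noteq> {}"
  show "\<exists>m\<in>T. \<forall>t\<in>T. m \<le> t"
  proof (cases "T \<inter> A = {} \<or> T \<inter> B = {}")
    case True
    then have "T \<subseteq> A \<or> T \<subseteq> B" using T by blast
    then show ?thesis
      using well_ordered_setD[OF assms(1) _ T(2)] well_ordered_setD[OF assms(2) _ T(2)] by metis
  next
    case False
    obtain a where a: "a \<in> T \<inter> A" "\<And>t. t \<in> T \<inter> A \<Longrightarrow> a \<le> t"
      using well_ordered_setD[OF assms(1), of "T \<inter> A"] False by blast
    obtain b where b: "b \<in> T \<inter> B" "\<And>t. t \<in> T \<inter> B \<Longrightarrow> b \<le> t"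
      using well_ordered_setD[OF assms(2), of "T \<inter> B"] False by blast
    have "min a b \<in> T" using a b by (simp add: min_def)
    moreover have "min a b \<le> t" if "t \<in> T" for t
      using that a(2)[of t] b(2)[of t] T by (auto simp: min_le_iff_disj)
    ultimately show ?thesis by blast
  qed
qed

lemma well_ordered_set_finite: "finite S \<Longrightarrow> well_ordered_set S"
  unfolding well_ordered_set_def by (meson Min_in Min_le finite_subset)

lemma finite_if_well_ordered_both:
  assumes A: "well_ordered_set A" and B: "well_ordered_set (uminus ` A)"
  shows "finite A"
proof (rule ccontr)
  assume inf: "infinite A"
  define T where "T = {a \<in> A. finite {x \<in> A. x \<le> a}}"
  have TA: "T \<subseteq> A" unfolding T_def by blast
  obtain a where a: "a \<in> A" "\<And>t. t \<in> A \<Longrightarrow> a \<le> t"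
    using well_ordered_setD[OF A, of A] inf by (metis finite.emptyI subset_refl)
  have "{x \<in> A. x \<le> a} = {a}" using a by (auto intro: antisym)
  then have "a \<in> T" using a unfolding T_def by simp
  then obtain m' where m': "m' \<in> uminus ` T" "\<And>t. t \<in> uminus ` T \<Longrightarrow> m' \<le> t"
    using well_ordered_setD[OF B, of "uminus ` T"] TA by (metis empty_iff image_mono image_is_empty)
  define m where "m = - m'"
  have m: "m \<in> T" "\<And>t. t \<in> T \<Longrightarrow> t \<le> m" using m' unfolding m_def by force+
  have fm: "finite {x \<in> A. x \<le> m}" using m(1) unfolding T_def by blast
  have "{x \<in> A. m < x} \<noteq> {}"
  proof
    assume "{x \<in> A. m < x} = {}"
    then have "A = {x \<in> A. x \<le> m}" by force
    then show False using fm inf by metis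
  qed
  then obtain k where k: "k \<in> {x \<in> A. m < x}" "\<And>t. t \<in> {x \<in> A. m < x} \<Longrightarrow> k \<le> t"
    using well_ordered_setD[OF A, of "{x \<in> A. m < x}"] by blast
  have "{x \<in> A. x \<le> k} \<subseteq> insert k {x \<in> A. x \<le> m}"
    using k by force
  then have "k \<in> T" unfolding T_def using k(1) fm by (auto dest: finite_subset)
  then show False using m(2) k(1) by force
qed

lemma finite_well_ordered_pairs:
  assumes A: "well_ordered_set A" and B: "well_ordered_set B"
  shows "finite {q \<in> A. s - q \<in> B}"
proof (rule finite_if_well_ordered_both)
  show "well_ordered_set {q \<in> A. s - q \<in> B}"
    using A by (rule well_ordered_set_subset) blast
  show "well_ordered_set (uminus ` {q \<in> A. s - q \<in> B})"
    unfolding well_ordered_set_def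
  proof (intro allI impI)
    fix T assume T: "T \<subseteq> uminus ` {q \<in> A. s - q \<in> B}" "T \<noteq> {}"
    then have "(+) s ` T \<subseteq> B" by auto
    then obtain m where m: "m \<in> (+) s ` T" "\<And>t. t \<in> (+) s ` T \<Longrightarrow> m \<le> t"
      using well_ordered_setD[OF B, of "(+) s ` T"] T(2) by blast
    then show "\<exists>m\<in>T. \<forall>t\<in>T. m \<le> t" by force
  qed
qed

lemma well_ordered_set_plus:
  assumes A: "well_ordered_set A" and B: "well_ordered_set B"
  shows "well_ordered_set {s. \<exists>a\<in>A. \<exists>b\<in>B. s = a + b}"
proof (rule ccontr)
  assume "\<not> ?thesis"
  then obtain T where T: "T \<subseteq> {s. \<exists>a\<in>A. \<exists>b\<in>B. s = a + b}" "T \<noteq> {}"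
    and nomin: "\<And>m. m \<in> T \<Longrightarrow> \<exists>t\<in>T. t < m"
    unfolding well_ordered_set_def not_all not_imp bex_simps ball_simps not_le by blast
  obtain t0 where t0: "t0 \<in> T" using T by blast
  have "\<exists>f. \<forall>n. f n \<in> T \<and> f (Suc n) < f n"
    by (rule dependent_nat_choice[where P = "\<lambda>_ x. x \<in> T" and Q = "\<lambda>_ x y. y < x"]) (use t0 nomin in auto)
  then obtain f where f: "\<And>n::nat. f n \<in> T" "\<And>n. f (Suc n) < f n" by blast
  have dec: "f n < f m" if "m < n" for m n
    using lift_Suc_mono_less[of "\<lambda>n. - f n" m n] that f(2) by simp
  define P where "P = (\<lambda>n x. x \<in> A \<and> f n - x \<in> B)"
  define a where "a = (\<lambda>n. SOME x. P n x)"
  define b where "b = (\<lambda>n. f n - a n)"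
  have "P n (a n)" for n
  proof -
    obtain x y where "x \<in> A" "y \<in> B" "f n = x + y" using f(1)[of n] T(1) by blast
    then have "P n x" by (simp add: P_def)
    then show ?thesis unfolding a_def by (rule someI)
  qed
  then have ab: "\<And>n. a n \<in> A" "\<And>n. b n \<in> B" "\<And>n. f n = a n + b n"
    unfolding P_def b_def by auto
  obtain g :: "nat \<Rightarrow> nat" where g: "strict_mono g" "monoseq (\<lambda>n. a (g n))"
    using seq_monosub[of a] by blast
  have "\<exists>N. \<forall>n\<ge>N. a (g N) \<le> a (g n) \<and> (\<forall>m\<ge>n. a (g n) \<le> a (g m))"
  proof (cases "incseq (\<lambda>n. a (g n))")
    case True
    then show ?thesis unfolding incseq_def by blast
  next
    case False
    then have d: "decseq (\<lambda>n. a (g n))" using g(2) unfolding monoseq_iff by blast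
    obtain m where m: "m \<in> range (\<lambda>n. a (g n))" "\<And>t. t \<in> range (\<lambda>n. a (g n)) \<Longrightarrow> m \<le> t"
      using well_ordered_setD[OF A, of "range (\<lambda>n. a (g n))"] ab(1) by blast
    then obtain N where N: "m = a (g N)" by blast
    have "a (g n) = m" if "n \<ge> N" for n
      using d that m N unfolding decseq_def by (metis antisym rangeI)
    then show ?thesis by (metis N order_refl order_trans)
  qed
  then obtain N where N: "\<And>n m. n \<ge> N \<Longrightarrow> m \<ge> n \<Longrightarrow> a (g n) \<le> a (g m)" by blast
  have bdec: "b (g m) < b (g n)" if "n \<ge> N" "m > n" for n m
  proof -
    have "f (g m) < f (g n)" using dec g(1) that(2) by (simp add: strict_mono_def)
    then show ?thesis using N[OF that(1), of m] that(2) ab(3)[of "g m"] ab(3)[of "g n"] by linarith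
  qed
  obtain m where m: "m \<in> (\<lambda>n. b (g n)) ` {N..}" "\<And>t. t \<in> (\<lambda>n. b (g n)) ` {N..} \<Longrightarrow> m \<le> t"
    using well_ordered_setD[OF B, of "(\<lambda>n. b (g n)) ` {N..}"] ab(2) by blast
  then obtain n where n: "n \<ge> N" "m = b (g n)" by auto
  have "m \<le> b (g (Suc n))" using n(1) by (intro m(2)) auto
  then show False using bdec[OF n(1), of "Suc n"] n by simp
qed

text \<open>\<open>'a hahn\<close> is \<open>'a((\<hbar>\<^sup>\<rat>))\<close>; \<open>hcoeff a q\<close> is the coefficient of \<open>\<hbar>\<^sup>q\<close>.\<close>

typedef (overloaded) 'a hahn = "{f :: rat \<Rightarrow> 'a::zero. well_ordered_set {q. f q \<noteq> 0}}"
  morphisms hcoeff Abs_hahn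
  by (rule exI[of _ "\<lambda>_. 0"]) (simp add: well_ordered_set_def)

setup_lifting type_definition_hahn

lemma hahn_eqI: "(\<And>q. hcoeff a q = hcoeff b q) \<Longrightarrow> a = b"
  by (metis hcoeff_inject ext)

definition hsupp :: "'a::zero hahn \<Rightarrow> rat set" where
  "hsupp a = {q. hcoeff a q \<noteq> 0}"

lemma well_ordered_hsupp: "well_ordered_set (hsupp a)"
  using hcoeff[of a] by (simp add: hsupp_def)

instantiation hahn :: (zero) zero
begin
lift_definition zero_hahn :: "'a hahn" is "\<lambda>_. 0"
  by (simp add: well_ordered_set_def)
instance ..
end

lemma hcoeff_0 [simp]: "hcoeff 0 q = 0"
  by transfer simp

lift_definition hmonom :: "rat \<Rightarrow> 'a::zero \<Rightarrow> 'a hahn" is "\<lambda>r c q. if q = r then c else 0"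
  by (rule well_ordered_set_finite) (simp add: finite_subset[of _ "{_}"])

lemma hcoeff_hmonom [simp]: "hcoeff (hmonom r c) q = (if q = r then c else 0)"
  by transfer simp

instantiation hahn :: (zero_neq_one) zero_neq_one
begin
definition one_hahn :: "'a hahn" where "1 = hmonom 0 1"
instance
proof
  show "(0::'a hahn) \<noteq> 1"
    by (metis hcoeff_0 hcoeff_hmonom one_hahn_def zero_neq_one)
qed
end

instantiation hahn :: (comm_monoid_add) comm_monoid_add
begin
lift_definition plus_hahn :: "'a hahn \<Rightarrow> 'a hahn \<Rightarrow> 'a hahn" is "\<lambda>f g q. f q + g q"
proof -
  fix f g :: "rat \<Rightarrow> 'a"
  assume "well_ordered_set {q. f q \<noteq> 0}" "well_ordered_set {q. g q \<noteq> 0}"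
  note wo = well_ordered_set_Un[OF this]
  show "well_ordered_set {q. f q + g q \<noteq> 0}"
    by (rule well_ordered_set_subset[OF wo]) auto
qed
instance by standard (transfer; force simp: ac_simps)+
end

instantiation hahn :: (ab_group_add) ab_group_add
begin
lift_definition uminus_hahn :: "'a hahn \<Rightarrow> 'a hahn" is "\<lambda>f q. - f q"
  by simp
lift_definition minus_hahn :: "'a hahn \<Rightarrow> 'a hahn \<Rightarrow> 'a hahn" is "\<lambda>f g q. f q - g q"
proof -
  fix f g :: "rat \<Rightarrow> 'a"
  assume "well_ordered_set {q. f q \<noteq> 0}" "well_ordered_set {q. g q \<noteq> 0}"
  note wo = well_ordered_set_Un[OF this]
  show "well_ordered_set {q. f q - g q \<noteq> 0}"
    by (rule well_ordered_set_subset[OF wo]) auto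
qed
instance by standard (transfer; force)+
end

lemma hcoeff_add [simp]: "hcoeff (a + b) q = hcoeff a q + hcoeff b q"
  by transfer simp

lemma hcoeff_uminus [simp]: "hcoeff (- a) q = - hcoeff a q"
  by transfer simp

lemma hcoeff_diff [simp]: "hcoeff (a - b) q = hcoeff a q - hcoeff b q"
  by transfer simp

lemma finite_hahn_conv:
  fixes a :: "'a::zero hahn" and b :: "'b::zero hahn"
  shows "finite {q. hcoeff a q \<noteq> 0 \<and> hcoeff b (s - q) \<noteq> 0}"
  using finite_well_ordered_pairs[OF well_ordered_hsupp[of a] well_ordered_hsupp[of b], of s]
  by (simp add: hsupp_def)

instantiation hahn :: (comm_semiring_0) times
begin
lift_definition times_hahn :: "'a hahn \<Rightarrow> 'a hahn \<Rightarrow> 'a hahn" is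
  "\<lambda>f g s. \<Sum>q | f q \<noteq> 0 \<and> g (s - q) \<noteq> 0. f q * g (s - q)"
proof -
  fix f g :: "rat \<Rightarrow> 'a"
  assume "well_ordered_set {q. f q \<noteq> 0}" "well_ordered_set {q. g q \<noteq> 0}"
  note wo = well_ordered_set_plus[OF this]
  show "well_ordered_set {s. (\<Sum>q | f q \<noteq> 0 \<and> g (s - q) \<noteq> 0. f q * g (s - q)) \<noteq> 0}"
  proof (rule well_ordered_set_subset[OF wo], safe)
    fix s assume "(\<Sum>q | f q \<noteq> 0 \<and> g (s - q) \<noteq> 0. f q * g (s - q)) \<noteq> 0"
    then obtain q where "f q \<noteq> 0" "g (s - q) \<noteq> 0"
      by (blast elim: sum.not_neutral_contains_not_neutral)
    then show "\<exists>a\<in>{q. f q \<noteq> 0}. \<exists>b\<in>{q. g q \<noteq> 0}. s = a + b"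
      by (intro bexI[of _ q] bexI[of _ "s - q"]) auto
  qed
qed
instance ..
end

lemma hcoeff_mult:
  "hcoeff (a * b) s = (\<Sum>q | hcoeff a q \<noteq> 0 \<and> hcoeff b (s - q) \<noteq> 0. hcoeff a q * hcoeff b (s - q))"
  by transfer simp

lemma hcoeff_mult_superset:
  assumes "finite S" "{q. hcoeff a q \<noteq> 0 \<and> hcoeff b (s - q) \<noteq> 0} \<subseteq> S"
  shows "hcoeff (a * b) s = (\<Sum>q\<in>S. hcoeff a q * hcoeff b (s - q))"
  unfolding hcoeff_mult by (rule sum.mono_neutral_left) (use assms in auto)

lemma hsupp_mult: "hsupp (a * b) \<subseteq> {s. \<exists>q\<in>hsupp a. \<exists>r\<in>hsupp b. s = q + r}"
proof
  fix s assume "s \<in> hsupp (a * b)"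
  then have "hcoeff (a * b) s \<noteq> 0" by (simp add: hsupp_def)
  then obtain q where "hcoeff a q \<noteq> 0" "hcoeff b (s - q) \<noteq> 0"
    unfolding hcoeff_mult by (blast elim: sum.not_neutral_contains_not_neutral)
  then show "s \<in> {s. \<exists>q\<in>hsupp a. \<exists>r\<in>hsupp b. s = q + r}"
    unfolding hsupp_def by (intro CollectI bexI[of _ q] bexI[of _ "s - q"]) auto
qed

lemma hahn_mult_assoc:
  fixes a b c :: "'a::comm_semiring_0 hahn"
  shows "a * b * c = a * (b * c)"
proof (rule hahn_eqI)
  fix s
  let ?A = "hsupp a" let ?B = "hsupp b" let ?C = "hsupp c"
  define AB where "AB = {s. \<exists>q\<in>?A. \<exists>r\<in>?B. s = q + r}"
  define BC where "BC = {s. \<exists>q\<in>?B. \<exists>r\<in>?C. s = q + r}"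
  have woAB: "well_ordered_set AB" and woBC: "well_ordered_set BC"
    unfolding AB_def BC_def
    by (rule well_ordered_set_plus[OF well_ordered_hsupp well_ordered_hsupp])+
  define Q where "Q = {q \<in> AB. s - q \<in> ?C}"
  define P where "P = (\<lambda>q. {p \<in> ?A. q - p \<in> ?B})"
  define P' where "P' = {p \<in> ?A. s - p \<in> BC}"
  define Q' where "Q' = (\<lambda>p. {q \<in> ?B. s - p - q \<in> ?C})"
  have fin: "finite Q" "\<And>q. finite (P q)" "finite P'" "\<And>p. finite (Q' p)"
    unfolding Q_def P_def P'_def Q'_def
    by (rule finite_well_ordered_pairs[OF woAB well_ordered_hsupp]
        finite_well_ordered_pairs[OF well_ordered_hsupp well_ordered_hsupp]
        finite_well_ordered_pairs[OF well_ordered_hsupp woBC])+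
  have "hcoeff (a * b * c) s = (\<Sum>q\<in>Q. hcoeff (a * b) q * hcoeff c (s - q))"
    by (rule hcoeff_mult_superset[OF fin(1)])
      (use hsupp_mult[of a b] in \<open>auto simp: Q_def AB_def hsupp_def\<close>)
  also have "\<dots> = (\<Sum>q\<in>Q. \<Sum>p\<in>P q. hcoeff a p * hcoeff b (q - p) * hcoeff c (s - q))"
    by (rule sum.cong[OF refl], subst hcoeff_mult_superset[OF fin(2)])
      (auto simp: P_def hsupp_def sum_distrib_right)
  also have "\<dots> = (\<Sum>(q, p)\<in>Sigma Q P. hcoeff a p * hcoeff b (q - p) * hcoeff c (s - q))"
    by (rule sum.Sigma) (use fin in auto)
  also have "\<dots> = (\<Sum>(p, q)\<in>Sigma P' Q'. hcoeff a p * (hcoeff b q * hcoeff c (s - p - q)))"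
    by (rule sum.reindex_bij_witness[of _ "\<lambda>(p, q). (p + q, p)" "\<lambda>(q, p). (p, q - p)"])
      (auto simp: P_def Q_def P'_def Q'_def AB_def BC_def mult.assoc algebra_simps; force)+
  also have "\<dots> = (\<Sum>p\<in>P'. \<Sum>q\<in>Q' p. hcoeff a p * (hcoeff b q * hcoeff c (s - p - q)))"
    by (rule sum.Sigma[symmetric]) (use fin in auto)
  also have "\<dots> = (\<Sum>p\<in>P'. hcoeff a p * hcoeff (b * c) (s - p))"
    by (rule sum.cong[OF refl], subst hcoeff_mult_superset[OF fin(4)])
      (auto simp: Q'_def hsupp_def sum_distrib_left)
  also have "\<dots> = hcoeff (a * (b * c)) s"
    by (rule hcoeff_mult_superset[OF fin(3), symmetric])
      (use hsupp_mult[of b c] in \<open>auto simp: P'_def BC_def hsupp_def\<close>)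
  finally show "hcoeff (a * b * c) s = hcoeff (a * (b * c)) s" .
qed

instance hahn :: (comm_ring_1) comm_ring_1
proof
  fix a b c :: "'a hahn"
  show "a * b * c = a * (b * c)" by (rule hahn_mult_assoc)
  show "a * b = b * a"
    by (rule hahn_eqI, unfold hcoeff_mult, rule sum.reindex_bij_witness[of _ "\<lambda>q. s - q" "\<lambda>q. s - q" for s])
      (auto simp: mult.commute)
  show "1 * a = a"
  proof (rule hahn_eqI)
    fix s show "hcoeff (1 * a) s = hcoeff a s"
      by (subst hcoeff_mult_superset[of "{0}"]) (auto simp: one_hahn_def split: if_splits)
  qed
  show "(a + b) * c = a * c + b * c"
  proof (rule hahn_eqI)
    fix s
    let ?S = "{q. hcoeff a q \<noteq> 0 \<and> hcoeff c (s - q) \<noteq> 0} \<union> {q. hcoeff b q \<noteq> 0 \<and> hcoeff c (s - q) \<noteq> 0}"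
    have "finite ?S" by (simp add: finite_hahn_conv)
    note * = hcoeff_mult_superset[OF this]
    show "hcoeff ((a + b) * c) s = hcoeff (a * c + b * c) s"
      unfolding hcoeff_add
      by (subst (1 2 3) *) (auto simp: sum.distrib distrib_right)
  qed
qed

lemma hmonom_mult: "hmonom q c * hmonom r d = hmonom (q + r) (c * (d::'a::comm_ring_1))"
proof (rule hahn_eqI)
  fix s show "hcoeff (hmonom q c * hmonom r d) s = hcoeff (hmonom (q + r) (c * d)) s"
    by (subst hcoeff_mult_superset[of "{q}"]) (auto split: if_splits)
qed

text \<open>Order of a nonzero series: the least element of its support.\<close>

definition hval :: "'a::zero hahn \<Rightarrow> rat" where
  "hval a = (LEAST q. hcoeff a q \<noteq> 0)"

lemma hval:
  assumes "a \<noteq> 0"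
  shows "hcoeff a (hval a) \<noteq> 0" "q < hval a \<Longrightarrow> hcoeff a q = 0"
proof -
  have "hsupp a \<noteq> {}" using assms by (auto simp: hsupp_def intro: hahn_eqI)
  then obtain m where m: "m \<in> hsupp a" "\<And>t. t \<in> hsupp a \<Longrightarrow> m \<le> t"
    using well_ordered_setD[OF well_ordered_hsupp[of a], of "hsupp a"] by blast
  have "hval a = m"
    unfolding hval_def by (rule Least_equality) (use m in \<open>auto simp: hsupp_def\<close>)
  then show "hcoeff a (hval a) \<noteq> 0" "q < hval a \<Longrightarrow> hcoeff a q = 0"
    using m by (force simp: hsupp_def)+
qed

lemma hval_eqI:
  assumes "hcoeff a q \<noteq> 0" "\<And>r. r < q \<Longrightarrow> hcoeff a r = 0"
  shows "hval a = q"
  unfolding hval_def by (rule Least_equality) (use assms in \<open>auto simp: not_less[symmetric]\<close>)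

lemma hcoeff_mult_lowest:
  assumes "\<And>q. q < v \<Longrightarrow> hcoeff a q = 0" "\<And>q. q < w \<Longrightarrow> hcoeff b q = 0"
  shows "hcoeff (a * b) (v + w) = hcoeff a v * hcoeff b w"
    and "s < v + w \<Longrightarrow> hcoeff (a * b) s = 0"
proof -
  have "{q. hcoeff a q \<noteq> 0 \<and> hcoeff b (v + w - q) \<noteq> 0} \<subseteq> {v}"
  proof safe
    fix q assume q: "hcoeff a q \<noteq> 0" "hcoeff b (v + w - q) \<noteq> 0"
    have "\<not> q < v" "\<not> v + w - q < w" using assms q by blast+
    then show "q = v" by linarith
  qed
  then show "hcoeff (a * b) (v + w) = hcoeff a v * hcoeff b w"
    by (subst hcoeff_mult_superset[of "{v}"]) auto
  show "hcoeff (a * b) s = 0" if "s < v + w"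
  proof -
    have "{q. hcoeff a q \<noteq> 0 \<and> hcoeff b (s - q) \<noteq> 0} = {}"
    proof safe
      fix q assume q: "hcoeff a q \<noteq> 0" "hcoeff b (s - q) \<noteq> 0"
      have "\<not> q < v" "\<not> s - q < w" using assms q by blast+
      then show "q \<in> {}" using that by linarith
    qed
    then show ?thesis unfolding hcoeff_mult by (simp only: sum.empty)
  qed
qed

instance hahn :: (idom) idom
proof
  fix a b :: "'a hahn"
  assume "a \<noteq> 0" "b \<noteq> 0"
  then have "hcoeff (a * b) (hval a + hval b) \<noteq> 0"
    using hcoeff_mult_lowest(1)[OF hval(2)[of a] hval(2)[of b]] hval(1)[of a] hval(1)[of b] by simp
  then show "a * b \<noteq> 0" by force
qed

definition hpos :: "'a::{zero,ord} hahn \<Rightarrow> bool" where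
  "hpos a \<longleftrightarrow> a \<noteq> 0 \<and> 0 < hcoeff a (hval a)"

lemma hpos_iff:
  "hpos (a :: 'a::{zero,order} hahn) \<longleftrightarrow> (\<exists>q. 0 < hcoeff a q \<and> (\<forall>r<q. hcoeff a r = 0))"
  (is "_ \<longleftrightarrow> ?R")
proof
  assume "hpos a"
  then show ?R unfolding hpos_def using hval[of a] by blast
next
  assume ?R
  then obtain q where q: "0 < hcoeff a q" "\<And>r. r < q \<Longrightarrow> hcoeff a r = 0" by blast
  have "hval a = q" using q by (intro hval_eqI) auto
  moreover have "a \<noteq> 0" using q(1) by auto
  ultimately show "hpos a" using q unfolding hpos_def by simp
qed

lemma hpos_add: "hpos a \<Longrightarrow> hpos b \<Longrightarrow> hpos (a + b)" for a b :: "'a::linordered_idom hahn"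
proof -
  assume "hpos a" "hpos b"
  then obtain q r where q: "0 < hcoeff a q" "\<And>s. s < q \<Longrightarrow> hcoeff a s = 0"
    and r: "0 < hcoeff b r" "\<And>s. s < r \<Longrightarrow> hcoeff b s = 0"
    unfolding hpos_iff by blast
  have "0 < hcoeff (a + b) (min q r) \<and> (\<forall>s<min q r. hcoeff (a + b) s = 0)"
    using q r by (cases q r rule: linorder_cases) (auto simp: min_def)
  then show ?thesis unfolding hpos_iff by blast
qed

lemma hpos_mult: "hpos a \<Longrightarrow> hpos b \<Longrightarrow> hpos (a * b)" for a b :: "'a::linordered_idom hahn"
proof -
  assume "hpos a" "hpos b"
  then obtain q r where q: "0 < hcoeff a q" "\<And>s. s < q \<Longrightarrow> hcoeff a s = 0"
    and r: "0 < hcoeff b r" "\<And>s. s < r \<Longrightarrow> hcoeff b s = 0"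
    unfolding hpos_iff by blast
  have "0 < hcoeff (a * b) (q + r) \<and> (\<forall>s<q + r. hcoeff (a * b) s = 0)"
    using hcoeff_mult_lowest[of q a r b] q r by auto
  then show ?thesis unfolding hpos_iff by blast
qed

lemma hpos_uminus: "hpos (- a) \<longleftrightarrow> a \<noteq> 0 \<and> \<not> hpos a" for a :: "'a::linordered_idom hahn"
proof -
  have "hval (- a) = hval a" by (simp add: hval_def)
  then show ?thesis
    unfolding hpos_def using hval(1)[of a] by (cases "a = 0") auto
qed

instantiation hahn :: (linordered_idom) linordered_idom
begin
definition less_hahn :: "'a hahn \<Rightarrow> 'a hahn \<Rightarrow> bool" where
  "a < b \<longleftrightarrow> hpos (b - a)"
definition less_eq_hahn :: "'a hahn \<Rightarrow> 'a hahn \<Rightarrow> bool" where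
  "a \<le> b \<longleftrightarrow> a = b \<or> hpos (b - a)"
definition "\<bar>a :: 'a hahn\<bar> = (if a < 0 then - a else a)"
definition "sgn (a :: 'a hahn) = (if a = 0 then 0 else if 0 < a then 1 else - 1)"
instance
proof
  fix a b c :: "'a hahn"
  have neg: "hpos (a - b) \<longleftrightarrow> a \<noteq> b \<and> \<not> hpos (b - a)" for a b :: "'a hahn"
    using hpos_uminus[of "b - a"] by auto
  have irr: "\<not> hpos (0 :: 'a hahn)" by (simp add: hpos_def)
  show "(a < b) = (a \<le> b \<and> \<not> b \<le> a)"
    using neg[of a b] irr by (auto simp: less_hahn_def less_eq_hahn_def)
  show "a \<le> a" by (simp add: less_eq_hahn_def)
  show "a \<le> c" if "a \<le> b" "b \<le> c"
    using that hpos_add[of "b - a" "c - b"] by (auto simp: less_eq_hahn_def)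
  show "a = b" if "a \<le> b" "b \<le> a"
    using that neg[of a b] by (auto simp: less_eq_hahn_def)
  show "a \<le> b \<or> b \<le> a" using neg[of a b] by (auto simp: less_eq_hahn_def)
  show "c + a \<le> c + b" if "a \<le> b" using that by (auto simp: less_eq_hahn_def)
  show "c * a < c * b" if "a < b" "0 < c"
    using that hpos_mult[of c "b - a"] by (auto simp: less_hahn_def right_diff_distrib)
  show "\<bar>a\<bar> = (if a < 0 then - a else a)" by (rule abs_hahn_def)
  show "sgn a = (if a = 0 then 0 else if 0 < a then 1 else - 1)" by (rule sgn_hahn_def)
qed
end

lift_definition hof_real :: "real hahn \<Rightarrow> complex hahn" is "\<lambda>f q. complex_of_real (f q)"
  by simp

lift_definition hcnj :: "('m \<Rightarrow> complex) hahn \<Rightarrow> ('m \<Rightarrow> complex) hahn" is "\<lambda>f q p. cnj (f q p)"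
  by (simp add: fun_eq_iff zero_fun_def)

text \<open>Scalars act on function-valued series by multiplication with the series of constant
  functions; multiplication in \<open>('m \<Rightarrow> complex) hahn\<close> is the pointwise one.\<close>

lift_definition hconst :: "complex hahn \<Rightarrow> ('m \<Rightarrow> complex) hahn" is "\<lambda>f q p. f q"
  by (simp add: fun_eq_iff zero_fun_def)

definition hscale :: "complex hahn \<Rightarrow> ('m \<Rightarrow> complex) hahn \<Rightarrow> ('m \<Rightarrow> complex) hahn"
  (infixr "\<cdot>\<^sub>h" 75) where
  "a \<cdot>\<^sub>h f = hconst a * f"

definition hbar :: "complex hahn" where
  "hbar = hmonom 1 1"

definition inverse_i_hbar :: "complex hahn" where
  "inverse_i_hbar = hmonom (- 1) (1 / \<i>)"

lemma inverse_i_hbar: "inverse_i_hbar * (hmonom 0 \<i> * hbar) = 1"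
  by (simp add: inverse_i_hbar_def hbar_def hmonom_mult one_hahn_def)


section \<open>Symplectic manifolds\<close>

text \<open>Points of \<open>\<real>\<^sup>n\<close> are those of \<^const>\<open>Euclidean_space\<close>: functions \<open>nat \<Rightarrow> real\<close> vanishing
  from index \<open>n\<close> on. This keeps the dimension a term (\<open>n = 0\<close> included).\<close>

definition partial_deriv :: "nat \<Rightarrow> ((nat \<Rightarrow> real) \<Rightarrow> 'b::real_normed_vector) \<Rightarrow> (nat \<Rightarrow> real) \<Rightarrow> 'b" where
  "partial_deriv i f x = vector_derivative (\<lambda>t. f (x(i := t))) (at (x i))"

primrec partial_derivs ::
    "nat list \<Rightarrow> ((nat \<Rightarrow> real) \<Rightarrow> 'b::real_normed_vector) \<Rightarrow> (nat \<Rightarrow> real) \<Rightarrow> 'b" where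
  "partial_derivs [] f = f"
| "partial_derivs (i # is) f = partial_deriv i (partial_derivs is f)"

text \<open>Only meant for \<open>V\<close> open in \<open>Euclidean_space n\<close>: all iterated partial derivatives exist and
  are continuous.\<close>

definition smooth_on :: "nat \<Rightarrow> (nat \<Rightarrow> real) set \<Rightarrow> ((nat \<Rightarrow> real) \<Rightarrow> 'b::real_normed_vector) \<Rightarrow> bool" where
  "smooth_on n V f \<longleftrightarrow>
    (\<forall>is. set is \<subseteq> {..<n} \<longrightarrow>
      continuous_on V (partial_derivs is f) \<and>
      (\<forall>i<n. \<forall>x\<in>V. (\<lambda>t. partial_derivs is f (x(i := t))) differentiable at (x i)))"

type_synonym 'm chart = "'m set \<times> ('m \<Rightarrow> nat \<Rightarrow> real)"

abbreviation chart_inv :: "'m chart \<Rightarrow> (nat \<Rightarrow> real) \<Rightarrow> 'm" where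
  "chart_inv c \<equiv> inv_into (fst c) (snd c)"

abbreviation chart_image :: "'m chart \<Rightarrow> (nat \<Rightarrow> real) set" where
  "chart_image c \<equiv> snd c ` fst c"

text \<open>The underlying set of the manifold is the type \<open>'m\<close>; \<open>A\<close> is an atlas, not necessarily
  a maximal one.\<close>

definition smooth_manifold ::
    "nat \<Rightarrow> 'm::{t2_space, second_countable_topology} chart set \<Rightarrow> bool" where
  "smooth_manifold n A \<longleftrightarrow>
    \<Union> (fst ` A) = UNIV \<and>
    (\<forall>(U, \<phi>)\<in>A. open U \<and> openin (Euclidean_space n) (\<phi> ` U) \<and>
      homeomorphic_map (top_of_set U) (subtopology (Euclidean_space n) (\<phi> ` U)) \<phi>) \<and>
    (\<forall>(U, \<phi>)\<in>A. \<forall>(U', \<phi>')\<in>A. \<forall>i<n.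
      smooth_on n (\<phi> ` (U \<inter> U')) (\<lambda>x. \<phi>' (inv_into U \<phi> x) i))"

definition smooth_functions :: "nat \<Rightarrow> 'm chart set \<Rightarrow> ('m \<Rightarrow> 'b::real_normed_vector) set" where
  "smooth_functions n A = {f. \<forall>c\<in>A. smooth_on n (chart_image c) (f \<circ> chart_inv c)}"

text \<open>Tangent vectors are derivations; they are set to \<open>0\<close> on nonsmooth functions so that equality
  of tangent vectors is equality in HOL.\<close>

definition tangent_space :: "nat \<Rightarrow> 'm chart set \<Rightarrow> 'm \<Rightarrow> (('m \<Rightarrow> real) \<Rightarrow> real) set" where
  "tangent_space n A p = {v.
    (\<forall>f\<in>smooth_functions n A. \<forall>g\<in>smooth_functions n A.
      v (f + g) = v f + v g \<and> v (f * g) = f p * v g + v f * g p) \<and>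
    (\<forall>f\<in>smooth_functions n A. \<forall>c. v (\<lambda>x. c * f x) = c * v f) \<and>
    (\<forall>f. f \<notin> smooth_functions n A \<longrightarrow> v f = 0)}"

definition coord_vector :: "nat \<Rightarrow> 'm chart set \<Rightarrow> 'm chart \<Rightarrow> nat \<Rightarrow> 'm \<Rightarrow> ('m \<Rightarrow> real) \<Rightarrow> real" where
  "coord_vector n A c i p f =
    (if f \<in> smooth_functions n A then partial_deriv i (f \<circ> chart_inv c) (snd c p) else 0)"

type_synonym 'm two_form = "'m \<Rightarrow> (('m \<Rightarrow> real) \<Rightarrow> real) \<Rightarrow> (('m \<Rightarrow> real) \<Rightarrow> real) \<Rightarrow> real"

definition form_coeff ::
    "nat \<Rightarrow> 'm chart set \<Rightarrow> 'm two_form \<Rightarrow> 'm chart \<Rightarrow> nat \<Rightarrow> nat \<Rightarrow> (nat \<Rightarrow> real) \<Rightarrow> real" where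
  "form_coeff n A \<omega> c i j x =
    \<omega> (chart_inv c x) (coord_vector n A c i (chart_inv c x)) (coord_vector n A c j (chart_inv c x))"

definition smooth_two_form :: "nat \<Rightarrow> 'm chart set \<Rightarrow> 'm two_form \<Rightarrow> bool" where
  "smooth_two_form n A \<omega> \<longleftrightarrow>
    (\<forall>p. \<forall>u\<in>tangent_space n A p. \<forall>v\<in>tangent_space n A p. \<forall>w\<in>tangent_space n A p. \<forall>a.
      \<omega> p (u + v) w = \<omega> p u w + \<omega> p v w \<and>
      \<omega> p (\<lambda>f. a * v f) w = a * \<omega> p v w \<and>
      \<omega> p v w = - \<omega> p w v) \<and>
    (\<forall>c\<in>A. \<forall>i<n. \<forall>j<n. smooth_on n (chart_image c) (form_coeff n A \<omega> c i j))"

definition closed_two_form :: "nat \<Rightarrow> 'm chart set \<Rightarrow> 'm two_form \<Rightarrow> bool" where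
  "closed_two_form n A \<omega> \<longleftrightarrow>
    (\<forall>c\<in>A. \<forall>i<n. \<forall>j<n. \<forall>k<n. \<forall>x\<in>chart_image c.
      partial_deriv i (form_coeff n A \<omega> c j k) x +
      partial_deriv j (form_coeff n A \<omega> c k i) x +
      partial_deriv k (form_coeff n A \<omega> c i j) x = 0)"

definition nondegenerate_two_form :: "nat \<Rightarrow> 'm chart set \<Rightarrow> 'm two_form \<Rightarrow> bool" where
  "nondegenerate_two_form n A \<omega> \<longleftrightarrow>
    (\<forall>p. \<forall>v\<in>tangent_space n A p. (\<forall>w\<in>tangent_space n A p. \<omega> p v w = 0) \<longrightarrow> v = 0)"

definition symplectic_manifold ::
    "nat \<Rightarrow> 'm::{t2_space, second_countable_topology} chart set \<Rightarrow> 'm two_form \<Rightarrow> bool" where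
  "symplectic_manifold n A \<omega> \<longleftrightarrow>
    smooth_manifold n A \<and> smooth_two_form n A \<omega> \<and> closed_two_form n A \<omega> \<and>
    nondegenerate_two_form n A \<omega>"

text \<open>\<open>X\<^sub>f\<close> is given by \<open>\<omega>(X\<^sub>f, \<cdot>) = df\<close> and \<open>{f, g} = \<omega>(X\<^sub>f, X\<^sub>g)\<close>, so that \<open>{q, p} = 1\<close> for
  \<open>\<omega> = dq \<and> dp\<close>; the bracket of complex-valued functions is the complex-bilinear extension.\<close>

definition hamiltonian_vector ::
    "nat \<Rightarrow> 'm chart set \<Rightarrow> 'm two_form \<Rightarrow> ('m \<Rightarrow> real) \<Rightarrow> 'm \<Rightarrow> ('m \<Rightarrow> real) \<Rightarrow> real" where
  "hamiltonian_vector n A \<omega> f p =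
    (THE v. v \<in> tangent_space n A p \<and> (\<forall>w\<in>tangent_space n A p. \<omega> p v w = w f))"

definition poisson_real ::
    "nat \<Rightarrow> 'm chart set \<Rightarrow> 'm two_form \<Rightarrow> ('m \<Rightarrow> real) \<Rightarrow> ('m \<Rightarrow> real) \<Rightarrow> 'm \<Rightarrow> real" where
  "poisson_real n A \<omega> f g p =
    \<omega> p (hamiltonian_vector n A \<omega> f p) (hamiltonian_vector n A \<omega> g p)"

definition poisson ::
    "nat \<Rightarrow> 'm chart set \<Rightarrow> 'm two_form \<Rightarrow> ('m \<Rightarrow> complex) \<Rightarrow> ('m \<Rightarrow> complex) \<Rightarrow> 'm \<Rightarrow> complex" where
  "poisson n A \<omega> f g p = Complex
    (poisson_real n A \<omega> (Re \<circ> f) (Re \<circ> g) p - poisson_real n A \<omega> (Im \<circ> f) (Im \<circ> g) p)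
    (poisson_real n A \<omega> (Re \<circ> f) (Im \<circ> g) p + poisson_real n A \<omega> (Im \<circ> f) (Re \<circ> g) p)"


section \<open>Star products and states\<close>

definition smooth_series :: "nat \<Rightarrow> 'm chart set \<Rightarrow> ('m \<Rightarrow> complex) hahn set" where
  "smooth_series n A = {f. \<forall>q. hcoeff f q \<in> smooth_functions n A}"

text \<open>Bidifferential operators of finite order. Multi-indices are encoded as lists of coordinate
  indices; as partial derivatives commute, the redundancy does not change which operators are
  obtained.\<close>

definition bidifferential_operator ::
    "nat \<Rightarrow> 'm chart set \<Rightarrow> (('m \<Rightarrow> complex) \<Rightarrow> ('m \<Rightarrow> complex) \<Rightarrow> ('m \<Rightarrow> complex)) \<Rightarrow> bool" where
  "bidifferential_operator n A B \<longleftrightarrow>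
    (\<forall>f\<in>smooth_functions n A. \<forall>g\<in>smooth_functions n A. B f g \<in> smooth_functions n A) \<and>
    (\<exists>N. \<forall>c\<in>A. \<exists>b :: nat list \<Rightarrow> nat list \<Rightarrow> (nat \<Rightarrow> real) \<Rightarrow> complex.
      (\<forall>\<alpha> \<beta>. smooth_on n (chart_image c) (b \<alpha> \<beta>)) \<and>
      (\<forall>f\<in>smooth_functions n A. \<forall>g\<in>smooth_functions n A. \<forall>p\<in>fst c.
        B f g p =
          (\<Sum>\<alpha> | set \<alpha> \<subseteq> {..<n} \<and> length \<alpha> \<le> N. \<Sum>\<beta> | set \<beta> \<subseteq> {..<n} \<and> length \<beta> \<le> N.
            b \<alpha> \<beta> (snd c p) *
            partial_derivs \<alpha> (f \<circ> chart_inv c) (snd c p) *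
            partial_derivs \<beta> (g \<circ> chart_inv c) (snd c p))))"

type_synonym 'm product = "('m \<Rightarrow> complex) hahn \<Rightarrow> ('m \<Rightarrow> complex) hahn \<Rightarrow> ('m \<Rightarrow> complex) hahn"

text \<open>Coefficient of \<open>\<hbar>\<^sup>s\<close> in \<open>\<Sum>k. C\<^sub>k(f, g) \<hbar>\<^sup>k\<close>; by \<open>finite_star_index\<close> below the sum is finite.\<close>

definition star_coeff ::
    "(nat \<Rightarrow> ('m \<Rightarrow> complex) \<Rightarrow> ('m \<Rightarrow> complex) \<Rightarrow> ('m \<Rightarrow> complex)) \<Rightarrow>
      ('m \<Rightarrow> complex) hahn \<Rightarrow> ('m \<Rightarrow> complex) hahn \<Rightarrow> rat \<Rightarrow> 'm \<Rightarrow> complex" where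
  "star_coeff C f g s =
    (\<Sum>(k, q) | hcoeff f q \<noteq> 0 \<and> hcoeff g (s - of_nat k - q) \<noteq> 0.
      C k (hcoeff f q) (hcoeff g (s - of_nat k - q)))"

lemma finite_star_index:
  fixes f :: "'a::zero hahn" and g :: "'b::zero hahn"
  shows "finite {(k, q). hcoeff f q \<noteq> 0 \<and> hcoeff g (s - of_nat k - q) \<noteq> 0}"
proof -
  have "well_ordered_set (range of_nat)"
    unfolding well_ordered_set_def
  proof (intro allI impI)
    fix T :: "rat set" assume T: "T \<subseteq> range of_nat" "T \<noteq> {}"
    let ?k = "LEAST k. of_nat k \<in> T"
    obtain k :: nat where "of_nat k \<in> T" using T by blast
    then have "of_nat ?k \<in> T" by (rule LeastI)
    moreover have "of_nat ?k \<le> t" if "t \<in> T" for t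
    proof -
      obtain j :: nat where j: "t = of_nat j" using \<open>t \<in> T\<close> T(1) by blast
      then have "?k \<le> j" using \<open>t \<in> T\<close> by (intro Least_le) simp
      then show ?thesis using j by simp
    qed
    ultimately show "\<exists>m\<in>T. \<forall>t\<in>T. m \<le> t" by blast
  qed
  note woN = this
  define S where "S = {s. \<exists>a\<in>range of_nat. \<exists>b\<in>hsupp f. s = a + b}"
  define R where "R = {u \<in> S. s - u \<in> hsupp g}"
  have "well_ordered_set S"
    unfolding S_def by (rule well_ordered_set_plus[OF woN well_ordered_hsupp])
  then have "finite R"
    unfolding R_def by (rule finite_well_ordered_pairs[OF _ well_ordered_hsupp])
  moreover have "finite {q \<in> hsupp f. u - q \<in> range of_nat}" for u
    by (rule finite_well_ordered_pairs[OF well_ordered_hsupp woN])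
  ultimately have fin: "finite (Sigma R (\<lambda>u. {q \<in> hsupp f. u - q \<in> range of_nat}))"
    by blast
  let ?h = "\<lambda>(k::nat, q). (of_nat k + q :: rat, q)"
  let ?I = "{(k, q). hcoeff f q \<noteq> 0 \<and> hcoeff g (s - of_nat k - q) \<noteq> 0}"
  have "?h ` ?I \<subseteq> Sigma R (\<lambda>u. {q \<in> hsupp f. u - q \<in> range of_nat})"
    by (auto simp: R_def S_def hsupp_def algebra_simps)
  then have "finite (?h ` ?I)" using fin by (rule finite_subset)
  moreover have "inj_on ?h ?I" by (auto simp: inj_on_def)
  ultimately show ?thesis by (rule finite_imageD)
qed

definition star_product ::
    "nat \<Rightarrow> 'm chart set \<Rightarrow> 'm two_form \<Rightarrow> 'm product \<Rightarrow> bool" where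
  "star_product n A \<omega> star \<longleftrightarrow>
    (\<forall>f\<in>smooth_series n A. \<forall>g\<in>smooth_series n A. \<forall>h\<in>smooth_series n A. \<forall>a.
      star (f + g) h = star f h + star g h \<and>
      star f (g + h) = star f g + star f h \<and>
      star (a \<cdot>\<^sub>h f) g = a \<cdot>\<^sub>h star f g \<and>
      star f (a \<cdot>\<^sub>h g) = a \<cdot>\<^sub>h star f g \<and>
      star (star f g) h = star f (star g h)) \<and>
    (\<exists>C. (\<forall>k. bidifferential_operator n A (C k)) \<and>
      (\<forall>f\<in>smooth_series n A. \<forall>g\<in>smooth_series n A. \<forall>s. hcoeff (star f g) s = star_coeff C f g s) \<and>
      (\<forall>f\<in>smooth_functions n A. \<forall>g\<in>smooth_functions n A.
        C 0 f g = f * g \<and>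
        C 1 f g - C 1 g f = (\<lambda>p. \<i> * poisson n A \<omega> f g p)) \<and>
      (\<forall>k\<ge>1. \<forall>f\<in>smooth_functions n A. C k 1 f = 0 \<and> C k f 1 = 0))"

type_synonym 'm functional = "('m \<Rightarrow> complex) hahn \<Rightarrow> complex hahn"

definition linear_functional :: "nat \<Rightarrow> 'm chart set \<Rightarrow> 'm functional \<Rightarrow> bool" where
  "linear_functional n A \<rho> \<longleftrightarrow>
    (\<forall>f\<in>smooth_series n A. \<forall>g\<in>smooth_series n A. \<forall>a.
      \<rho> (f + g) = \<rho> f + \<rho> g \<and> \<rho> (a \<cdot>\<^sub>h f) = a * \<rho> f)"

definition positive_functional ::
    "nat \<Rightarrow> 'm chart set \<Rightarrow> 'm product \<Rightarrow> 'm functional \<Rightarrow> bool" where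
  "positive_functional n A star \<rho> \<longleftrightarrow>
    linear_functional n A \<rho> \<and>
    (\<forall>f\<in>smooth_series n A. \<exists>r\<ge>0. \<rho> (star (hcnj f) f) = hof_real r)"

definition state :: "nat \<Rightarrow> 'm chart set \<Rightarrow> 'm product \<Rightarrow> 'm functional \<Rightarrow> bool" where
  "state n A star \<rho> \<longleftrightarrow> positive_functional n A star \<rho> \<and> \<rho> 1 = 1"

definition gelfand_ideal ::
    "nat \<Rightarrow> 'm chart set \<Rightarrow> 'm product \<Rightarrow> 'm functional \<Rightarrow> ('m \<Rightarrow> complex) hahn set" where
  "gelfand_ideal n A star \<rho> = {f \<in> smooth_series n A. \<rho> (star (hcnj f) f) = 0}"

definition deviation :: "'m functional \<Rightarrow> ('m \<Rightarrow> complex) hahn \<Rightarrow> ('m \<Rightarrow> complex) hahn" where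
  "deviation \<rho> X = X - \<rho> X \<cdot>\<^sub>h 1"

definition star_bracket :: "'m product \<Rightarrow> 'm product" where
  "star_bracket star f g = inverse_i_hbar \<cdot>\<^sub>h (star f g - star g f)"

definition robertson_schroedinger_intelligent ::
    "'m product \<Rightarrow> 'm functional \<Rightarrow> ('m \<Rightarrow> complex) hahn ^ 'k::finite \<Rightarrow> bool" where
  "robertson_schroedinger_intelligent star \<rho> X \<longleftrightarrow>
    det (\<chi> j k. hmonom 0 (1 / 2) *
      \<rho> (star (deviation \<rho> (X $ j)) (deviation \<rho> (X $ k)) +
         star (deviation \<rho> (X $ k)) (deviation \<rho> (X $ j)))) =
    det (\<chi> j k. hmonom 0 (1 / 2) * hbar * \<rho> (star_bracket star (X $ j) (X $ k)))"

end

theory Submission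
  imports Defs
begin

text \<open>
  Positivity turns a state into a Hermitian form, and the statement is the equality case of its
  Cauchy--Schwarz inequality. Put \<open>\<langle>f, g\<rangle> = \<rho>(cnj f * g)\<close>. This is sesquilinear with values
  \<open>\<langle>f, f\<rangle> \<ge> 0\<close>, so polarization gives \<open>\<langle>g, f\<rangle> = cnj \<langle>f, g\<rangle>\<close> (\<open>form_hermitian\<close>), even if
  conjugation is not an anti-automorphism of the star product. Taking \<open>f = 1\<close> shows that \<open>\<rho>\<close> is
  real on real elements, hence the deviations \<open>\<delta>X\<^sub>j\<close> are real and \<open>a\<^sub>j\<^sub>k := \<rho>(\<delta>X\<^sub>j * \<delta>X\<^sub>k) = \<langle>\<delta>X\<^sub>j, \<delta>X\<^sub>k\<rangle>\<close> is their Gram matrix.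

  The two matrices in the definition of an intelligent state are the symmetric part of \<open>a\<close> and
  \<open>-\<i>\<close> times its antisymmetric part, because the scalars \<open>\<rho>(X\<^sub>j)\<close> are central and drop out of
  commutators. For size two the determinants are \<open>a\<^sub>1\<^sub>1 a\<^sub>2\<^sub>2 - (a\<^sub>1\<^sub>2 + a\<^sub>2\<^sub>1)\<^sup>2/4\<close> and
  \<open>-(a\<^sub>1\<^sub>2 - a\<^sub>2\<^sub>1)\<^sup>2/4\<close>, and they differ by \<open>det a\<close>; so \<open>\<rho>\<close> is intelligent iff the Gram matrix is
  singular (\<open>intelligent_iff\<close>).

  A Gram matrix is singular iff some nontrivial combination is null (\<open>null_combination_iff\<close>).
  A kernel vector of \<open>a\<close> can be read off from its entries. Conversely, a null vector is orthogonal
  to everything (\<open>form_null_left\<close>), which puts its coefficients into the kernel of \<open>a\<close>. The usual proof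
  of that orthogonality divides by scalars; here it is arranged to use only that the scalars
  form an ordered integral domain.

  The remaining work is to see that smooth series are closed under all the operations involved,
  since bilinearity and positivity are available only for smooth series.
\<close>

section \<open>Smooth functions form a conjugation-invariant vector space\<close>

text \<open>A partial derivative of higher order looks at the lower-order one along a coordinate line
  through \<open>x\<close>, so identities between derivatives on \<open>V\<close> can be differentiated again only if \<open>V\<close> contains
  a segment of that line. \<open>V\<close> is open only relative to the subspace \<open>Euclidean_space n\<close>, hence \<open>i < n\<close>.\<close>

lemma eventually_coordinate_update_in:
  assumes V: "openin (Euclidean_space n) V" and x: "x \<in> V" and i: "i < n"
  shows "\<forall>\<^sub>F t in nhds (x i). x(i := t) \<in> V"
proof -
  obtain T where T: "open T" "V = T \<inter> {x. \<forall>i\<ge>n. x i = 0}"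
    using V unfolding Euclidean_space_def openin_subtopology euclidean_product_topology
    by auto
  have "continuous_on UNIV (\<lambda>t. (x(i := t)) j)" for j
    by (cases "j = i") simp_all
  then have "continuous_on UNIV (\<lambda>t. x(i := t))"
    by (rule continuous_on_coordinatewise_then_product)
  then have "open ((\<lambda>t. x(i := t)) -` T)"
    using open_vimage[OF T(1), of "\<lambda>t. x(i := t)"] by simp
  moreover have "x i \<in> (\<lambda>t. x(i := t)) -` T" using x T(2) by simp
  ultimately have "\<forall>\<^sub>F t in nhds (x i). t \<in> (\<lambda>t. x(i := t)) -` T"
    by (rule eventually_nhds_in_open)
  then show ?thesis by eventually_elim (use x i T(2) in auto)
qed

text \<open>Addition, scalar multiplication and complex conjugation are all instances of this shape, which is
  why two real-linear maps are carried along.\<close>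

lemma smooth_on_linear_combination:
  fixes f :: "(nat \<Rightarrow> real) \<Rightarrow> 'b::real_normed_vector"
    and g :: "(nat \<Rightarrow> real) \<Rightarrow> 'c::real_normed_vector"
    and L :: "'b \<Rightarrow> 'd::real_normed_vector"
  assumes V: "openin (Euclidean_space n) V"
    and f: "smooth_on n V f" and g: "smooth_on n V g"
    and L: "bounded_linear L" and M: "bounded_linear M"
  shows "smooth_on n V (\<lambda>x. L (f x) + M (g x))"
proof -
  let ?h = "\<lambda>x. L (f x) + M (g x)"
  let ?D = "\<lambda>js x. L (partial_derivs js f x) + M (partial_derivs js g x)"
  have line: "((\<lambda>t. ?D js (x(i := t))) has_vector_derivative ?D (i # js) x) (at (x i))"
    if "set js \<subseteq> {..<n}" "i < n" "x \<in> V" for js i x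
  proof -
    have "(\<lambda>t. partial_derivs js f (x(i := t))) differentiable at (x i)"
      "(\<lambda>t. partial_derivs js g (x(i := t))) differentiable at (x i)"
      using f g that unfolding smooth_on_def by blast+
    then show ?thesis
      by (auto simp: partial_deriv_def vector_derivative_works
          intro!: has_vector_derivative_add bounded_linear.has_vector_derivative[OF L]
            bounded_linear.has_vector_derivative[OF M])
  qed
  \<comment> \<open>Inductive step for \<open>eq\<close> below: the formula for \<open>js\<close> holds on all of \<open>V\<close>, hence on a segment
    around \<open>x\<close> in direction \<open>i\<close>, and may be differentiated there.\<close>
  have transfer: "((\<lambda>t. partial_derivs js ?h (x(i := t))) has_vector_derivative ?D (i # js) x) (at (x i))"
    if "\<And>y. y \<in> V \<Longrightarrow> partial_derivs js ?h y = ?D js y" "set js \<subseteq> {..<n}" "i < n" "x \<in> V" for js i x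
  proof -
    have "\<forall>\<^sub>F t in nhds (x i). ?D js (x(i := t)) = partial_derivs js ?h (x(i := t))"
      using eventually_coordinate_update_in[OF V that(4,3)]
      by eventually_elim (simp add: that(1))
    then have "((\<lambda>t. ?D js (x(i := t))) has_vector_derivative ?D (i # js) x) (at (x i)) \<longleftrightarrow>
      ((\<lambda>t. partial_derivs js ?h (x(i := t))) has_vector_derivative ?D (i # js) x) (at (x i))"
      by (intro has_vector_derivative_cong_ev) (auto dest: eventually_nhds_x_imp_x elim: eventually_mono)
    then show ?thesis using line[OF that(2-4)] by simp
  qed
  have eq: "partial_derivs js ?h x = ?D js x" if "set js \<subseteq> {..<n}" "x \<in> V" for js x
    using that
  proof (induction js arbitrary: x)
    case (Cons i js)
    then show ?case
      using vector_derivative_at[OF transfer[of js i x]] by (simp add: partial_deriv_def)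
  qed simp
  show ?thesis
    unfolding smooth_on_def
  proof (intro allI impI conjI ballI)
    fix js assume js: "set js \<subseteq> {..<n}"
    have "continuous_on V (partial_derivs js f)" "continuous_on V (partial_derivs js g)"
      using f g js unfolding smooth_on_def by blast+
    then have "continuous_on V (?D js)"
      by (intro continuous_on_add bounded_linear.continuous_on[OF L] bounded_linear.continuous_on[OF M])
    then show "continuous_on V (partial_derivs js ?h)"
      using eq[OF js] by (simp cong: continuous_on_cong)
    show "(\<lambda>t. partial_derivs js ?h (x(i := t))) differentiable at (x i)" if "i < n" "x \<in> V" for i x
      using transfer[OF eq[OF js] js that] by (rule differentiableI_vector)
  qed
qed

lemma partial_derivs_const: "\<exists>d. partial_derivs js (\<lambda>_. c) = (\<lambda>_. d)"
proof (induction js)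
  case (Cons i js)
  then obtain d where "partial_derivs js (\<lambda>_. c) = (\<lambda>_. d)" by blast
  then show ?case by (auto simp: partial_deriv_def fun_eq_iff)
qed auto

lemma smooth_on_const: "smooth_on n V (\<lambda>_. c)"
  unfolding smooth_on_def
proof (intro allI impI conjI ballI)
  fix js :: "nat list"
  obtain d where "partial_derivs js (\<lambda>_. c) = (\<lambda>_. d)" using partial_derivs_const by blast
  then show "continuous_on V (partial_derivs js (\<lambda>_. c))"
    and "(\<lambda>t. partial_derivs js (\<lambda>_. c) (x(i := t))) differentiable at (x i)" for x i
    by simp_all
qed

lemma smooth_functions_const: "(\<lambda>_. c) \<in> smooth_functions n A"
  by (simp add: smooth_functions_def comp_def smooth_on_const)

lemma smooth_functions_linear_combination:
  assumes A: "smooth_manifold n A"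
    and f: "f \<in> smooth_functions n A" and g: "g \<in> smooth_functions n A"
    and L: "bounded_linear L" and M: "bounded_linear M"
  shows "(\<lambda>p. L (f p) + M (g p)) \<in> smooth_functions n A"
  unfolding smooth_functions_def
proof (intro CollectI ballI)
  fix c assume c: "c \<in> A"
  then have "openin (Euclidean_space n) (chart_image c)"
    using A unfolding smooth_manifold_def by auto
  moreover have "smooth_on n (chart_image c) (f \<circ> chart_inv c)"
    "smooth_on n (chart_image c) (g \<circ> chart_inv c)"
    using f g c unfolding smooth_functions_def by blast+
  ultimately show "smooth_on n (chart_image c) ((\<lambda>p. L (f p) + M (g p)) \<circ> chart_inv c)"
    using smooth_on_linear_combination[OF _ _ _ L M] by (fastforce simp: comp_def)
qed

lemma smooth_functions_add:
  assumes "smooth_manifold n A" "f \<in> smooth_functions n A" "g \<in> smooth_functions n A"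
  shows "f + g \<in> smooth_functions n A"
  using smooth_functions_linear_combination[OF assms bounded_linear_ident bounded_linear_ident]
  by (simp add: plus_fun_def)

lemma smooth_functions_bounded_linear:
  assumes "smooth_manifold n A" "f \<in> smooth_functions n A" "bounded_linear L"
  shows "(\<lambda>p. L (f p)) \<in> smooth_functions n A"
  using smooth_functions_linear_combination[OF assms(1,2,2,3) bounded_linear_zero] by simp

lemma smooth_functions_sum:
  assumes "smooth_manifold n A" "\<And>i. i \<in> I \<Longrightarrow> F i \<in> smooth_functions n A"
  shows "sum F I \<in> smooth_functions n A"
  using assms(2)
proof (induction I rule: infinite_finite_induct)
  case (insert i I)
  then have "F i + sum F I \<in> smooth_functions n A"
    by (intro smooth_functions_add[OF assms(1)]) simp_all
  then show ?case using insert(1,2) by (metis sum.insert)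
qed (use smooth_functions_const[of 0 n A] in \<open>simp_all add: zero_fun_def\<close>)

section \<open>Conjugation of formal series\<close>

lift_definition hahn_cnj :: "complex hahn \<Rightarrow> complex hahn" is "\<lambda>f q. cnj (f q)"
  by simp

lift_definition hahn_Re :: "complex hahn \<Rightarrow> real hahn" is "\<lambda>f q. Re (f q)"
  by (erule well_ordered_set_subset) auto

lift_definition hahn_Im :: "complex hahn \<Rightarrow> real hahn" is "\<lambda>f q. Im (f q)"
  by (erule well_ordered_set_subset) auto

lemma hcoeff_hahn_cnj [simp]: "hcoeff (hahn_cnj a) q = cnj (hcoeff a q)"
  by transfer simp

lemma hcoeff_hahn_Re [simp]: "hcoeff (hahn_Re a) q = Re (hcoeff a q)"
  by transfer simp

lemma hcoeff_hahn_Im [simp]: "hcoeff (hahn_Im a) q = Im (hcoeff a q)"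
  by transfer simp

lemma hcoeff_hof_real [simp]: "hcoeff (hof_real a) q = complex_of_real (hcoeff a q)"
  by transfer simp

lemma hcoeff_hcnj [simp]: "hcoeff (hcnj f) q = (\<lambda>p. cnj (hcoeff f q p))"
  by transfer simp

lemma hcoeff_hconst [simp]: "hcoeff (hconst a) q = (\<lambda>p. hcoeff a q)"
  by transfer simp

lemma hof_real_0 [simp]: "hof_real 0 = 0"
  by (rule hahn_eqI) simp

lemma hof_real_add: "hof_real (a + b) = hof_real a + hof_real b"
  by (rule hahn_eqI) simp

lemma hof_real_uminus: "hof_real (- a) = - hof_real a"
  by (rule hahn_eqI) simp

lemma hof_real_mult: "hof_real (a * b) = hof_real a * hof_real b"
  by (rule hahn_eqI) (simp add: hcoeff_mult)

lemma hof_real_eq_iff [simp]: "hof_real a = hof_real b \<longleftrightarrow> a = b"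
proof
  assume "hof_real a = hof_real b"
  then have "hcoeff (hof_real a) q = hcoeff (hof_real b) q" for q by simp
  then show "a = b" by (intro hahn_eqI) simp
qed simp

lemma hahn_cnj_add: "hahn_cnj (a + b) = hahn_cnj a + hahn_cnj b"
  by (rule hahn_eqI) simp

lemma hahn_cnj_uminus: "hahn_cnj (- a) = - hahn_cnj a"
  by (rule hahn_eqI) simp

lemma hahn_cnj_mult: "hahn_cnj (a * b) = hahn_cnj a * hahn_cnj b"
  by (rule hahn_eqI) (simp add: hcoeff_mult cnj_sum)

lemma hahn_cnj_cnj [simp]: "hahn_cnj (hahn_cnj a) = a"
  by (rule hahn_eqI) simp

lemma hahn_cnj_0 [simp]: "hahn_cnj 0 = 0"
  by (rule hahn_eqI) simp

lemma hahn_cnj_1 [simp]: "hahn_cnj 1 = 1"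
  by (rule hahn_eqI) (simp add: one_hahn_def)

lemma hahn_cnj_hof_real [simp]: "hahn_cnj (hof_real r) = hof_real r"
  by (rule hahn_eqI) simp

lemma hmonom_0_mult: "hcoeff (hmonom 0 c * a) q = c * hcoeff a q"
  by (subst hcoeff_mult_superset[of "{0}"]) (auto split: if_splits)

lemma hmonom_0_i_squared: "hmonom 0 \<i> * hmonom 0 \<i> = (- 1 :: complex hahn)"
  by (rule hahn_eqI) (simp add: hmonom_mult one_hahn_def)

lemma hahn_Re_Im: "a = hof_real (hahn_Re a) + hmonom 0 \<i> * hof_real (hahn_Im a)"
  by (rule hahn_eqI) (simp add: hmonom_0_mult complex_eq)

text \<open>The square of the modulus is a sum of two squares in an ordered integral domain; this avoids any
  look at leading coefficients.\<close>

lemma hahn_mult_cnj: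
  obtains r where "r \<ge> 0" "a * hahn_cnj a = hof_real r" "r = 0 \<longleftrightarrow> a = 0"
proof
  let ?x = "hahn_Re a" and ?y = "hahn_Im a"
  let ?r = "?x * ?x + ?y * ?y"
  have cnj: "hahn_cnj a = hof_real ?x - hmonom 0 \<i> * hof_real ?y"
    by (rule hahn_eqI) (simp add: hmonom_0_mult complex_eq_iff)
  have "a * hahn_cnj a
      = hof_real ?x * hof_real ?x - (hmonom 0 \<i> * hmonom 0 \<i>) * (hof_real ?y * hof_real ?y)"
    unfolding cnj by (subst hahn_Re_Im[of a]) (simp add: algebra_simps)
  then show "a * hahn_cnj a = hof_real ?r"
    by (simp add: hmonom_0_i_squared hof_real_add hof_real_mult)
  show "?r \<ge> 0" by simp
  show "?r = 0 \<longleftrightarrow> a = 0"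
  proof
    assume "?r = 0"
    then have "?x = 0" "?y = 0" by (simp_all add: sum_squares_eq_zero_iff)
    then show "a = 0" by (subst hahn_Re_Im) simp
  next
    assume "a = 0"
    then have "?x = 0" "?y = 0" by (auto intro: hahn_eqI)
    then show "?r = 0" by simp
  qed
qed

text \<open>Cancels the factor two that polarization leaves behind.\<close>

lemma hahn_double_cancel: "a + a = b + b \<Longrightarrow> a = b" for a b :: "complex hahn"
proof (rule hahn_eqI)
  fix q assume "a + a = b + b"
  then have "hcoeff a q + hcoeff a q = hcoeff b q + hcoeff b q" by (metis hcoeff_add)
  then show "hcoeff a q = hcoeff b q" by simp
qed

section \<open>Function-valued series\<close>

lemma sum_fun_apply: "(\<Sum>i\<in>I. F i) p = (\<Sum>i\<in>I. F i p)"
  for F :: "'i \<Rightarrow> 'm \<Rightarrow> 'b::comm_monoid_add"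
  by (induction I rule: infinite_finite_induct) auto

lemma hconst_1: "hconst 1 = 1"
  by (rule hahn_eqI) (auto simp: one_hahn_def one_fun_def zero_fun_def)

lemma hscale_1 [simp]: "1 \<cdot>\<^sub>h f = f"
  by (simp add: hscale_def hconst_1)

lemma hscale_0_left [simp]: "0 \<cdot>\<^sub>h f = 0" for f :: "('m \<Rightarrow> complex) hahn"
proof -
  have "hconst 0 = (0 :: ('m \<Rightarrow> complex) hahn)" by (rule hahn_eqI) (auto simp: fun_eq_iff)
  then show ?thesis by (simp add: hscale_def)
qed

lemma hconst_mult: "(hconst (a * b) :: ('m \<Rightarrow> complex) hahn) = hconst a * hconst b"
proof -
  have "(\<lambda>p. c) = (0 :: 'm \<Rightarrow> complex) \<longleftrightarrow> c = 0" for c by (auto simp: fun_eq_iff)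
  then show ?thesis by (intro hahn_eqI) (auto simp: hcoeff_mult sum_fun_apply fun_eq_iff)
qed

lemma hscale_hscale: "a \<cdot>\<^sub>h b \<cdot>\<^sub>h f = (a * b) \<cdot>\<^sub>h f"
  by (simp add: hscale_def hconst_mult mult.assoc)

lemma hscale_add_right: "a \<cdot>\<^sub>h (f + g) = a \<cdot>\<^sub>h f + a \<cdot>\<^sub>h g"
  by (simp add: hscale_def distrib_left)

lemma hconst_uminus: "hconst (- a) = - hconst a"
  by (rule hahn_eqI) (auto simp: fun_eq_iff)

lemma hscale_minus: "(- a) \<cdot>\<^sub>h f = - (a \<cdot>\<^sub>h f)"
  by (simp add: hscale_def hconst_uminus)

lemma hcnj_add: "hcnj (f + g) = hcnj f + hcnj g"
  by (rule hahn_eqI) (auto simp: fun_eq_iff)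

lemma hcnj_diff: "hcnj (f - g) = hcnj f - hcnj g"
  by (rule hahn_eqI) (auto simp: fun_eq_iff)

lemma hcnj_1 [simp]: "hcnj 1 = 1"
  by (rule hahn_eqI) (auto simp: fun_eq_iff one_hahn_def)

lemma hcnj_hscale: "hcnj (a \<cdot>\<^sub>h f) = hahn_cnj a \<cdot>\<^sub>h hcnj f"
proof -
  have nz: "(\<lambda>p. cnj (u p)) = 0 \<longleftrightarrow> u = 0" "(\<lambda>p. cnj c) = (0 :: 'a \<Rightarrow> complex) \<longleftrightarrow> (\<lambda>p. c) = (0 :: 'a \<Rightarrow> complex)"
    for u :: "'a \<Rightarrow> complex" and c by (auto simp: fun_eq_iff)
  show ?thesis
    by (rule hahn_eqI) (auto simp: hscale_def hcoeff_mult nz sum_fun_apply cnj_sum fun_eq_iff)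
qed

lemma smooth_series_add:
  assumes "smooth_manifold n A" "f \<in> smooth_series n A" "g \<in> smooth_series n A"
  shows "f + g \<in> smooth_series n A"
  using assms by (simp add: smooth_series_def smooth_functions_add)

lemma smooth_series_hscale:
  assumes "smooth_manifold n A" "f \<in> smooth_series n A"
  shows "a \<cdot>\<^sub>h f \<in> smooth_series n A"
proof -
  have "(\<lambda>p. c) * hcoeff f q \<in> smooth_functions n A" for c q
    using smooth_functions_bounded_linear[OF assms(1) _ bounded_linear_mult_right[of c]] assms(2)
    by (simp add: smooth_series_def times_fun_def)
  then show ?thesis
    by (simp add: smooth_series_def hscale_def hcoeff_mult smooth_functions_sum[OF assms(1)])
qed

lemma smooth_series_hcnj:
  assumes "smooth_manifold n A" "f \<in> smooth_series n A"
  shows "hcnj f \<in> smooth_series n A"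
  using smooth_functions_bounded_linear[OF assms(1) _ bounded_linear_cnj] assms(2)
  by (simp add: smooth_series_def)

lemma smooth_series_1: "1 \<in> smooth_series n A"
  using smooth_functions_const[of "0 :: complex" n A] smooth_functions_const[of "1 :: complex" n A]
  by (simp add: smooth_series_def one_hahn_def zero_fun_def one_fun_def)

section \<open>The Hermitian form of a state\<close>

locale star_state =
  fixes n :: nat
    and A :: "'m::{t2_space, second_countable_topology} chart set"
    and \<omega> :: "'m two_form"
    and star :: "'m product"
    and \<rho> :: "'m functional"
  assumes manifold: "smooth_manifold n A"
    and star: "star_product n A \<omega> star"
    and state: "state n A star \<rho>"
begin

abbreviation "\<C> \<equiv> smooth_series n A"

lemmas series_closed [simp, intro] =
  smooth_series_add[OF manifold] smooth_series_hscale[OF manifold]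
  smooth_series_hcnj[OF manifold] smooth_series_1[of n A]

lemma series_diff [simp, intro]: "f \<in> \<C> \<Longrightarrow> g \<in> \<C> \<Longrightarrow> f - g \<in> \<C>"
  using series_closed(1)[of f "- g"] series_closed(2)[of g "- 1"] by (simp add: hscale_minus)

lemma star_add:
  assumes "f \<in> \<C>" "g \<in> \<C>" "h \<in> \<C>"
  shows "star (f + g) h = star f h + star g h"
    and "star f (g + h) = star f g + star f h"
  using star assms unfolding star_product_def by blast+

lemma star_hscale:
  assumes "f \<in> \<C>" "g \<in> \<C>"
  shows "star (a \<cdot>\<^sub>h f) g = a \<cdot>\<^sub>h star f g"
    and "star f (a \<cdot>\<^sub>h g) = a \<cdot>\<^sub>h star f g"
  using star assms unfolding star_product_def by blast+

lemma star_closed [simp, intro]: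
  assumes "f \<in> \<C>" "g \<in> \<C>"
  shows "star f g \<in> \<C>"
proof -
  obtain C where "\<forall>k. bidifferential_operator n A (C k)"
    "\<forall>f\<in>\<C>. \<forall>g\<in>\<C>. \<forall>s. hcoeff (star f g) s = star_coeff C f g s"
    using star unfolding star_product_def by (elim conjE exE) rule
  then have C: "\<And>k. bidifferential_operator n A (C k)"
    "\<And>f g s. f \<in> \<C> \<Longrightarrow> g \<in> \<C> \<Longrightarrow> hcoeff (star f g) s = star_coeff C f g s"
    by simp_all
  have "C k u v \<in> smooth_functions n A"
    if "u \<in> smooth_functions n A" "v \<in> smooth_functions n A" for k u v
    using C(1) that unfolding bidifferential_operator_def by blast
  then have "C k (hcoeff f q) (hcoeff g r) \<in> smooth_functions n A" for k q r
    using assms by (simp add: smooth_series_def)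
  then have "star_coeff C f g s \<in> smooth_functions n A" for s
    unfolding star_coeff_def by (intro smooth_functions_sum[OF manifold]) auto
  then show ?thesis using C(2)[OF assms] by (simp add: smooth_series_def)
qed

text \<open>Since \<open>C\<^sub>k\<close> kills \<open>1\<close> for \<open>k \<ge> 1\<close>, a single index of the sum \<open>star_coeff\<close> contributes, and it
  contributes \<open>C\<^sub>0\<close>.\<close>

lemma star_1:
  assumes f: "f \<in> \<C>"
  shows star_1_left: "star 1 f = f" and star_1_right: "star f 1 = f"
proof -
  obtain C where
    "\<forall>f\<in>\<C>. \<forall>g\<in>\<C>. \<forall>s. hcoeff (star f g) s = star_coeff C f g s"
    "\<forall>f\<in>smooth_functions n A. \<forall>g\<in>smooth_functions n A. C 0 f g = f * g \<and>
      C 1 f g - C 1 g f = (\<lambda>p. \<i> * poisson n A \<omega> f g p)"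
    "\<forall>k\<ge>1. \<forall>f\<in>smooth_functions n A. C k 1 f = 0 \<and> C k f 1 = 0"
    using star unfolding star_product_def by (elim conjE exE) rule
  then have C: "\<And>f g s. f \<in> \<C> \<Longrightarrow> g \<in> \<C> \<Longrightarrow> hcoeff (star f g) s = star_coeff C f g s"
    "\<And>f g. f \<in> smooth_functions n A \<Longrightarrow> g \<in> smooth_functions n A \<Longrightarrow> C 0 f g = f * g"
    "\<And>k f. k \<ge> 1 \<Longrightarrow> f \<in> smooth_functions n A \<Longrightarrow> C k 1 f = 0 \<and> C k f 1 = 0"
    by simp_all
  have sm: "hcoeff f q \<in> smooth_functions n A" "(1 :: 'm \<Rightarrow> complex) \<in> smooth_functions n A" for q
    using f smooth_functions_const[of 1 n A] by (simp_all add: smooth_series_def one_fun_def)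
  have 0: "C k 1 (hcoeff f q) = (if k = 0 then hcoeff f q else 0)"
    "C k (hcoeff f q) 1 = (if k = 0 then hcoeff f q else 0)" for k q
    using C(2)[OF sm(2) sm(1)] C(2)[OF sm(1) sm(2)] C(3)[OF _ sm(1)] by auto
  show "star 1 f = f"
  proof (rule hahn_eqI)
    fix s
    let ?I = "{(k :: nat, q). hcoeff (1 :: ('m \<Rightarrow> complex) hahn) q \<noteq> 0 \<and> hcoeff f (s - of_nat k - q) \<noteq> 0}"
    have "hcoeff (star 1 f) s = (\<Sum>(k, q)\<in>?I. if k = 0 \<and> q = 0 then hcoeff f s else 0)"
      unfolding C(1)[OF series_closed(4) f] star_coeff_def
      by (intro sum.cong) (auto simp: one_hahn_def 0 split: if_splits)
    also have "\<dots> = (\<Sum>x\<in>?I. if x = (0, 0) then hcoeff f s else 0)"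
      by (intro sum.cong) auto
    also have "\<dots> = hcoeff f s"
      using finite_star_index[of 1 f s] by (subst sum.delta) (auto simp: one_hahn_def)
    finally show "hcoeff (star 1 f) s = hcoeff f s" .
  qed
  show "star f 1 = f"
  proof (rule hahn_eqI)
    fix s
    let ?I = "{(k :: nat, q). hcoeff f q \<noteq> 0 \<and> hcoeff (1 :: ('m \<Rightarrow> complex) hahn) (s - of_nat k - q) \<noteq> 0}"
    have "hcoeff (star f 1) s = (\<Sum>(k, q)\<in>?I. if k = 0 \<and> q = s then hcoeff f s else 0)"
      unfolding C(1)[OF f series_closed(4)] star_coeff_def
      by (intro sum.cong) (auto simp: one_hahn_def 0 split: if_splits)
    also have "\<dots> = (\<Sum>x\<in>?I. if x = (0, s) then hcoeff f s else 0)"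
      by (intro sum.cong) auto
    also have "\<dots> = hcoeff f s"
      using finite_star_index[of f 1 s] by (subst sum.delta) (auto simp: one_hahn_def)
    finally show "hcoeff (star f 1) s = hcoeff f s" .
  qed
qed

lemma rho_add: "f \<in> \<C> \<Longrightarrow> g \<in> \<C> \<Longrightarrow> \<rho> (f + g) = \<rho> f + \<rho> g"
  and rho_hscale: "f \<in> \<C> \<Longrightarrow> \<rho> (a \<cdot>\<^sub>h f) = a * \<rho> f"
  using state unfolding state_def positive_functional_def linear_functional_def by blast+

lemma rho_diff:
  assumes "f \<in> \<C>" "g \<in> \<C>"
  shows "\<rho> (f - g) = \<rho> f - \<rho> g"
  using rho_add[of f "- g"] rho_hscale[OF assms(2), of "- 1"] assms
    series_closed(2)[of g "- 1"] by (simp add: hscale_minus)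

definition form :: "('m \<Rightarrow> complex) hahn \<Rightarrow> ('m \<Rightarrow> complex) hahn \<Rightarrow> complex hahn" where
  "form f g = \<rho> (star (hcnj f) g)"

lemma form_add:
  assumes "f \<in> \<C>" "g \<in> \<C>" "h \<in> \<C>"
  shows "form (f + g) h = form f h + form g h"
    and "form f (g + h) = form f g + form f h"
  using assms by (simp_all add: form_def hcnj_add star_add rho_add)

lemma form_hscale:
  assumes "f \<in> \<C>" "g \<in> \<C>"
  shows "form (a \<cdot>\<^sub>h f) g = hahn_cnj a * form f g"
    and "form f (a \<cdot>\<^sub>h g) = a * form f g"
  using assms by (simp_all add: form_def hcnj_hscale star_hscale rho_hscale)

lemma form_linear_combination:
  assumes "f \<in> \<C>" "g \<in> \<C>" "h \<in> \<C>"
  shows "form h (a \<cdot>\<^sub>h f + b \<cdot>\<^sub>h g) = a * form h f + b * form h g"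
    and "form (a \<cdot>\<^sub>h f + b \<cdot>\<^sub>h g) h = hahn_cnj a * form f h + hahn_cnj b * form g h"
  using assms by (simp_all add: form_add form_hscale)

lemma form_self:
  assumes "f \<in> \<C>"
  obtains r where "r \<ge> 0" "form f f = hof_real r"
  using state assms unfolding state_def positive_functional_def form_def by blast

text \<open>Polarization: \<open>\<langle>f + g, f + g\<rangle>\<close> and \<open>\<langle>f + \<i>g, f + \<i>g\<rangle>\<close> are real, so \<open>\<langle>f, g\<rangle> + \<langle>g, f\<rangle>\<close> and
  \<open>\<i>(\<langle>f, g\<rangle> - \<langle>g, f\<rangle>)\<close> are real.\<close>

lemma form_hermitian:
  assumes f: "f \<in> \<C>" and g: "g \<in> \<C>"
  shows "form g f = hahn_cnj (form f g)"
proof -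
  let ?i = "hmonom 0 \<i> :: complex hahn"
  let ?p = "form f g" and ?q = "form g f"
  have real: "hahn_cnj (form h h) = form h h" if "h \<in> \<C>" for h
    using form_self[OF that] by (metis hahn_cnj_hof_real)
  have i: "hahn_cnj ?i = - ?i" by (rule hahn_eqI) simp
  have ii: "?i * (?i * a) = - a" for a
    by (simp add: mult.assoc[symmetric] hmonom_0_i_squared)
  have "form (f + g) (f + g) = form f f + (?p + ?q) + form g g"
    using f g by (simp add: form_add)
  then have 1: "hahn_cnj ?p + hahn_cnj ?q = ?p + ?q"
    using real[of "f + g"] f g by (simp add: hahn_cnj_add real)
  have exp: "form (1 \<cdot>\<^sub>h f + ?i \<cdot>\<^sub>h g) (1 \<cdot>\<^sub>h f + ?i \<cdot>\<^sub>h g) = form f f + ?i * (?p - ?q) + form g g"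
    using f g by (simp only: form_linear_combination series_closed i hahn_cnj_1)
      (simp add: algebra_simps ii)
  have "form f f + (- ?i) * (hahn_cnj ?p - hahn_cnj ?q) + form g g = form f f + ?i * (?p - ?q) + form g g"
    using real[of "1 \<cdot>\<^sub>h f + ?i \<cdot>\<^sub>h g"] f g unfolding exp
    by (simp add: hahn_cnj_add hahn_cnj_mult real i diff_conv_add_uminus hahn_cnj_uminus del: add_uminus_conv_diff)
  then have "?i * (hahn_cnj ?q - hahn_cnj ?p) = ?i * (?p - ?q)"
    by (simp add: algebra_simps)
  then have "?i * (?i * (hahn_cnj ?q - hahn_cnj ?p)) = ?i * (?i * (?p - ?q))" by simp
  then have 2: "hahn_cnj ?q - hahn_cnj ?p = ?p - ?q"
    unfolding ii by (simp only: neg_equal_iff_equal)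
  have "?q + ?q = (?p + ?q) - (?p - ?q)" by simp
  also have "\<dots> = hahn_cnj ?p + hahn_cnj ?p"
    unfolding 1[symmetric] 2[symmetric] by simp
  finally show ?thesis by (rule hahn_double_cancel)
qed

text \<open>Suppose \<open>\<langle>f, f\<rangle> = 0\<close> and put \<open>p = \<langle>f, g\<rangle>\<close>, \<open>c = \<bar>p\<bar>\<^sup>2\<close> and \<open>d = \<langle>g, g\<rangle>\<close>. Then \<open>\<langle>tf + g, tf + g\<rangle>\<close> has no
  quadratic term in \<open>t\<close>, and if \<open>c \<noteq> 0\<close> it equals \<open>-(d + 2) < 0\<close> at \<open>t = -(d + 1) p/c\<close>. Multiplying the
  vector by \<open>c\<close> clears the denominator; the value becomes \<open>-(d + 2) c\<^sup>2\<close>, which forces \<open>c = 0\<close>.\<close>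

lemma form_null_left:
  assumes f: "f \<in> \<C>" and g: "g \<in> \<C>" and null: "form f f = 0"
  shows "form g f = 0"
proof -
  let ?p = "form f g"
  obtain c where c: "c \<ge> 0" "?p * hahn_cnj ?p = hof_real c" "c = 0 \<longleftrightarrow> ?p = 0"
    by (rule hahn_mult_cnj)
  obtain d where d: "d \<ge> 0" "form g g = hof_real d" by (rule form_self[OF g])
  define a where "a = - (hof_real (d + 1) * ?p)"
  let ?h = "a \<cdot>\<^sub>h f + hof_real c \<cdot>\<^sub>h g"
  have h: "?h \<in> \<C>" using f g by blast
  obtain r where r: "r \<ge> 0" "form ?h ?h = hof_real r" by (rule form_self[OF h])
  have "form ?h ?h = hahn_cnj a * hof_real c * ?p + hof_real c * a * hahn_cnj ?p
      + hof_real c * hof_real c * form g g"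
    using f g null form_hermitian[OF f g]
    by (simp add: form_linear_combination algebra_simps)
  also have "hahn_cnj a * hof_real c * ?p = - (hof_real (d + 1) * hof_real c * (?p * hahn_cnj ?p))"
    by (simp add: a_def hahn_cnj_uminus hahn_cnj_mult algebra_simps)
  also have "hof_real c * a * hahn_cnj ?p = - (hof_real (d + 1) * hof_real c * (?p * hahn_cnj ?p))"
    by (simp add: a_def algebra_simps)
  also have "- (hof_real (d + 1) * hof_real c * (?p * hahn_cnj ?p)) +
      - (hof_real (d + 1) * hof_real c * (?p * hahn_cnj ?p)) + hof_real c * hof_real c * form g g
      = hof_real (- ((d + 1) * c * c) + - ((d + 1) * c * c) + c * c * d)"
    unfolding c(2) d(2) hof_real_add hof_real_uminus hof_real_mult ..
  finally have "r = - ((d + 1) * c * c) + - ((d + 1) * c * c) + c * c * d"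
    unfolding r(2) hof_real_eq_iff .
  then have "r = - ((d + 1 + 1) * (c * c))" by (simp add: algebra_simps)
  then have le: "(d + 1 + 1) * (c * c) \<le> 0" using r(1) by simp
  have "c * c = 0"
  proof (rule ccontr)
    assume "c * c \<noteq> 0"
    then have cc: "c * c > 0" using c(1) by simp
    have dd: "d + 1 + 1 > 0" using d(1) by (simp add: add_nonneg_pos)
    show False using leD[OF le] mult_pos_pos[OF dd cc] by blast
  qed
  then have "?p = 0" using c(3) by simp
  then show ?thesis using form_hermitian[OF f g] by simp
qed

text \<open>If the Gram matrix is singular and \<open>\<langle>f, f\<rangle> \<noteq> 0\<close>, then \<open>(\<langle>f, g\<rangle>, -\<langle>f, f\<rangle>)\<close> is orthogonal to its first row by
  construction and to its second row by singularity. In the other direction, the kernel vector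
  \<open>(u, v)\<close> annihilates the determinant by Cramer's rule.\<close>

lemma null_combination_iff:
  assumes f: "f \<in> \<C>" and g: "g \<in> \<C>"
  shows "(\<exists>u v. (u \<noteq> 0 \<or> v \<noteq> 0) \<and> form (u \<cdot>\<^sub>h f + v \<cdot>\<^sub>h g) (u \<cdot>\<^sub>h f + v \<cdot>\<^sub>h g) = 0) \<longleftrightarrow>
    form f f * form g g = form f g * form g f"
proof
  assume "\<exists>u v. (u \<noteq> 0 \<or> v \<noteq> 0) \<and> form (u \<cdot>\<^sub>h f + v \<cdot>\<^sub>h g) (u \<cdot>\<^sub>h f + v \<cdot>\<^sub>h g) = 0"
  then obtain u v where uv: "u \<noteq> 0 \<or> v \<noteq> 0"
    and null: "form (u \<cdot>\<^sub>h f + v \<cdot>\<^sub>h g) (u \<cdot>\<^sub>h f + v \<cdot>\<^sub>h g) = 0" by blast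
  have h: "u \<cdot>\<^sub>h f + v \<cdot>\<^sub>h g \<in> \<C>" using f g by blast
  have 1: "u * form f f + v * form f g = 0"
    using form_null_left[OF h f null] f g by (simp add: form_linear_combination)
  have 2: "u * form g f + v * form g g = 0"
    using form_null_left[OF h g null] f g by (simp add: form_linear_combination)
  let ?d = "form f f * form g g - form f g * form g f"
  have "u * ?d = form g g * (u * form f f + v * form f g) - form f g * (u * form g f + v * form g g)"
    "v * ?d = form f f * (u * form g f + v * form g g) - form g f * (u * form f f + v * form f g)"
    by (simp_all add: algebra_simps)
  then have "u * ?d = 0" "v * ?d = 0" unfolding 1 2 by simp_all
  then show "form f f * form g g = form f g * form g f" using uv by auto
next
  assume eq: "form f f * form g g = form f g * form g f"
  show "\<exists>u v. (u \<noteq> 0 \<or> v \<noteq> 0) \<and> form (u \<cdot>\<^sub>h f + v \<cdot>\<^sub>h g) (u \<cdot>\<^sub>h f + v \<cdot>\<^sub>h g) = 0"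
  proof (cases "form f f = 0")
    case True
    then show ?thesis
      by - (rule exI[of _ 1], rule exI[of _ 0], simp)
  next
    case False
    let ?h = "form f g \<cdot>\<^sub>h f + (- form f f) \<cdot>\<^sub>h g"
    have h: "?h \<in> \<C>" using f g by blast
    have "form f ?h = 0" "form g ?h = 0"
      using f g eq by (simp_all add: form_linear_combination algebra_simps)
    then have "form ?h ?h = 0" using f g h by (simp add: form_linear_combination(2))
    then show ?thesis using False by (intro exI[of _ "form f g"] exI[of _ "- form f f"]) simp
  qed
qed

section \<open>Intelligent states\<close>

text \<open>Hermiticity against \<open>1\<close> gives \<open>\<rho>(X) = \<langle>1, X\<rangle> = cnj \<langle>X, 1\<rangle> = cnj \<rho>(X)\<close> for real \<open>X\<close>.\<close>

lemma deviation_real: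
  assumes X: "X \<in> \<C>" "hcnj X = X"
  shows "deviation \<rho> X \<in> \<C>" and "hcnj (deviation \<rho> X) = deviation \<rho> X"
proof -
  have "\<rho> X = hahn_cnj (\<rho> X)"
    using form_hermitian[of 1 X] X by (simp add: form_def star_1)
  then show "hcnj (deviation \<rho> X) = deviation \<rho> X"
    using X by (simp add: deviation_def hcnj_diff hcnj_hscale)
  show "deviation \<rho> X \<in> \<C>" using X by (auto simp: deviation_def)
qed

text \<open>The difference between \<open>\<delta>X * \<delta>Y\<close> and \<open>X * Y\<close> is symmetric in \<open>X\<close> and \<open>Y\<close>, since \<open>1\<close> is the unit of the
  star product.\<close>

lemma star_deviation_commutator:
  assumes X: "X \<in> \<C>" and Y: "Y \<in> \<C>"
  shows "star (deviation \<rho> X) (deviation \<rho> Y) - star (deviation \<rho> Y) (deviation \<rho> X)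
    = star X Y - star Y X"
proof -
  have dev: "star (deviation \<rho> X) (deviation \<rho> Y) = star X Y + (- \<rho> X) \<cdot>\<^sub>h Y +
      (- \<rho> Y) \<cdot>\<^sub>h X + (\<rho> Y * \<rho> X) \<cdot>\<^sub>h 1" if "X \<in> \<C>" "Y \<in> \<C>" for X Y
  proof -
    have e: "deviation \<rho> Z = Z + (- \<rho> Z) \<cdot>\<^sub>h 1" for Z
      by (simp add: deviation_def hscale_minus)
    show ?thesis
      using that unfolding e
      by (simp add: star_add star_hscale star_1 hscale_add_right
          hscale_hscale ac_simps)
  qed
  show ?thesis unfolding dev[OF X Y] dev[OF Y X] by (simp add: ac_simps)
qed

lemma rho_star_bracket:
  assumes "X \<in> \<C>" "Y \<in> \<C>"
  shows "hbar * \<rho> (star_bracket star X Y) = - hmonom 0 \<i> * (\<rho> (star X Y) - \<rho> (star Y X))"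
proof -
  have "hbar * inverse_i_hbar = - hmonom 0 \<i>"
    by (rule hahn_eqI) (simp add: hbar_def inverse_i_hbar_def hmonom_mult)
  then show ?thesis
    using assms by (simp add: star_bracket_def rho_hscale rho_diff
        mult.assoc[symmetric])
qed

lemma intelligent_iff:
  assumes X: "X1 \<in> \<C>" "hcnj X1 = X1" and Y: "X2 \<in> \<C>" "hcnj X2 = X2"
  shows "robertson_schroedinger_intelligent star \<rho> (vector [X1, X2] :: ('m \<Rightarrow> complex) hahn ^ 2) \<longleftrightarrow>
    form (deviation \<rho> X1) (deviation \<rho> X1) * form (deviation \<rho> X2) (deviation \<rho> X2)
    = form (deviation \<rho> X1) (deviation \<rho> X2) * form (deviation \<rho> X2) (deviation \<rho> X1)"
proof -
  let ?D1 = "deviation \<rho> X1" and ?D2 = "deviation \<rho> X2"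
  note D1 = deviation_real[OF X] and D2 = deviation_real[OF Y]
  let ?h = "hmonom 0 (1 / 2) :: complex hahn" and ?i = "hmonom 0 \<i> :: complex hahn"
  define a b c d where "a = form ?D1 ?D1" and "b = form ?D1 ?D2"
    and "c = form ?D2 ?D1" and "d = form ?D2 ?D2"
  have S: "\<rho> (star ?D1 ?D1) = a" "\<rho> (star ?D1 ?D2) = b" "\<rho> (star ?D2 ?D1) = c" "\<rho> (star ?D2 ?D2) = d"
    unfolding a_def b_def c_def d_def form_def using D1 D2 by simp_all
  have anti: "\<rho> (star ?D1 ?D1 + star ?D1 ?D1) = a + a" "\<rho> (star ?D1 ?D2 + star ?D2 ?D1) = b + c"
    "\<rho> (star ?D2 ?D1 + star ?D1 ?D2) = c + b" "\<rho> (star ?D2 ?D2 + star ?D2 ?D2) = d + d"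
    using D1 D2 by (simp_all only: rho_add star_closed S)
  have comm: "\<rho> (star X1 X2) - \<rho> (star X2 X1) = b - c"
    using arg_cong[OF star_deviation_commutator[OF X(1) Y(1)], of \<rho>] X Y D1 D2
    by (simp add: rho_diff S)
  then have comm': "\<rho> (star X2 X1) - \<rho> (star X1 X2) = - (b - c)"
    by (simp only: comm[symmetric] minus_diff_eq)
  have br: "?h * hbar * \<rho> (star_bracket star X1 X2) = - (?h * ?i * (b - c))"
    "?h * hbar * \<rho> (star_bracket star X2 X1) = ?h * ?i * (b - c)"
    "?h * hbar * \<rho> (star_bracket star X1 X1) = 0"
    "?h * hbar * \<rho> (star_bracket star X2 X2) = 0"
    using X Y comm
    by (simp_all only: mult.assoc rho_star_bracket comm comm' minus_mult_minus mult_minus_left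
        mult_minus_right diff_self mult_zero_right minus_zero minus_minus)
  have "robertson_schroedinger_intelligent star \<rho> (vector [X1, X2] :: ('m \<Rightarrow> complex) hahn ^ 2) \<longleftrightarrow>
    ?h * (a + a) * (?h * (d + d)) - ?h * (b + c) * (?h * (c + b))
      = 0 * 0 - - (?h * ?i * (b - c)) * (?h * ?i * (b - c))"
    unfolding robertson_schroedinger_intelligent_def
    by (simp only: det_2 vec_lambda_beta vector_2 br anti)
  also have "\<dots> \<longleftrightarrow> ?h * (a + a) * (?h * (d + d)) - ?h * (b + c) * (?h * (c + b))
      = (?i * ?i) * (?h * ?h * ((b - c) * (b - c)))"
    by (simp add: algebra_simps)
  \<comment> \<open>Collecting terms leaves \<open>(2h)\<^sup>2 (a d - b c)\<close> with \<open>h = 1/2\<close>.\<close>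
  also have "\<dots> \<longleftrightarrow> (?h + ?h) * (?h + ?h) * (a * d) = (?h + ?h) * (?h + ?h) * (b * c)"
    unfolding hmonom_0_i_squared by (simp add: algebra_simps)
  also have "?h + ?h = 1"
    by (rule hahn_eqI) (simp only: hcoeff_add hcoeff_hmonom one_hahn_def, simp)
  finally show ?thesis by (simp add: a_def b_def c_def d_def)
qed

end

theorem proposition6p3:
  fixes n :: nat
    and A :: "'m::{t2_space, second_countable_topology} chart set"
    and \<omega> :: "'m two_form"
    and star :: "'m product"
    and \<rho> :: "'m functional"
    and X1 X2 :: "('m \<Rightarrow> complex) hahn"
  assumes "symplectic_manifold n A \<omega>"
    and "star_product n A \<omega> star"
    and "state n A star \<rho>"
    and "X1 \<in> smooth_series n A" and "X2 \<in> smooth_series n A"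
    and "hcnj X1 = X1" and "hcnj X2 = X2"
  shows "robertson_schroedinger_intelligent star \<rho> (vector [X1, X2] :: ('m \<Rightarrow> complex) hahn ^ 2) \<longleftrightarrow>
    (\<exists>u1 u2. (u1 \<noteq> 0 \<or> u2 \<noteq> 0) \<and>
      u1 \<cdot>\<^sub>h deviation \<rho> X1 + u2 \<cdot>\<^sub>h deviation \<rho> X2 \<in> gelfand_ideal n A star \<rho>)"
proof -
  interpret star_state n A \<omega> star \<rho>
    using assms by unfold_locales (simp_all add: symplectic_manifold_def)
  note D1 = deviation_real(1)[OF assms(4,6)] and D2 = deviation_real(1)[OF assms(5,7)]
  have "u1 \<cdot>\<^sub>h deviation \<rho> X1 + u2 \<cdot>\<^sub>h deviation \<rho> X2 \<in> gelfand_ideal n A star \<rho> \<longleftrightarrow>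
    form (u1 \<cdot>\<^sub>h deviation \<rho> X1 + u2 \<cdot>\<^sub>h deviation \<rho> X2)
      (u1 \<cdot>\<^sub>h deviation \<rho> X1 + u2 \<cdot>\<^sub>h deviation \<rho> X2) = 0" for u1 u2
    using D1 D2 by (auto simp: gelfand_ideal_def form_def)
  then show ?thesis
    using intelligent_iff[OF assms(4,6,5,7)] null_combination_iff[OF D1 D2] by simp
qed

end
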